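(* Let $n\ge2$ be an integer, $N=2n+1$, $m_0=+1$ or $-1$, $m_N=-m_0$ and $m_j=m_0$ for $1\le j\le 2n=N-1$. Let $0\le\theta_0<2\pi$ and $0<a_1<a_2$ be constants, and $\theta_n^j=\frac{2(j-1)\pi}{n}+\theta_0$ for $1\le j\le n$. Consider the system $$\dot{\mathbf x}_j(t)=2m_j\sum_{k=1,k\ne j}^N m_k\frac{\mathbf x_j(t)-\mathbf x_k(t)}{|\mathbf x_j(t)-\mathbf x_k(t)|^2},\qquad 1\le j\le N,\quad t>0,$$ with initial data $$\mathbf x_N(0)=\mathbf 0,\qquad \mathbf x_j(0)=a_1(\cos\theta_n^j,\sin\theta_n^j)^T,\qquad \mathbf x_{n+j}(0)=a_2(\cos\theta_n^j,\sin\theta_n^j)^T,\qquad 1\le j\le n.$$ Then the solution can be given as $$\mathbf x_N(t)\equiv\mathbf 0,\qquad \mathbf x_j(t)=\sqrt{\rho_1(t)}\,(\cos\theta_n^j,\sin\theta_n^j)^T,\qquad \mathbf x_{n+j}(t)=\sqrt{\rho_2(t)}\,(\cos\theta_n^j,\sin\theta_n^j)^T,\qquad 1\le j\le n,$$ where: (i) when $n=2$, $\mathbf x_1(t)$, $\mathbf x_2(t)$ and $\mathbf x_5(t)$ form a collision cluster among the $5$ vortices and they will collide at the origin $(0,0)^T$ in finite time; (ii) when $n=3$, $$\rho_1(t)\sim\left(\frac{a_1a_2}{a_1+a_2}\right)^2,\qquad \rho_2(t)\sim12t,\qquad t\gg1;$$ (iii) when $n\ge4$, $$\rho_1(t)\sim\alpha_5t,\qquad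 \rho_2(t)\sim\beta_5t,\qquad t\gg1,$$ with $\alpha_5$ and $\beta_5$ being two positive constants satisfying $$0<\alpha_5<\beta_5,\qquad \alpha_5+\beta_5=8n-12,\qquad \beta_5-\alpha_5=4n\,\frac{\beta_5^{n/2}+\alpha_5^{n/2}}{\beta_5^{n/2}-\alpha_5^{n/2}} .$$ Specifically, when $n\gg1$, $\alpha_5\approx2n-6$ and $\beta_5\approx6n-6$.
   Context: Here $\mathbf x_j(t)\in\mathbb R^2$ is the center of the $j$-th of $N$ quantized vortices and $m_j\in\{+1,-1\}$ is its winding number. The notation $f(t)\sim g(t)$, $t\gg1$, is the usual notation for asymptotic behaviour at large time. The symbol $\approx$ for $n\gg1$ denotes approximate equality for large $n$, with no quantitative error specified. For a set $I\subseteq\{1,\dots,N\}$ with at least two elements, the vortices in $I$ form a (finite time) collision cluster among the $N$ vortices if there are a finite time $0<T_c<+\infty$ and a fixed point $\mathbf x^0\in\mathbb R^2$ such that, with $d_{jl}(t)=|\mathbf x_j(t)-\mathbf x_l(t)|$, one has $\min_{1\le j<l\le N}d_{jl}(t)>0$ for $0\le t<T_c$, $\lim_{t\to T_c^-}\mathbf x_j(t)=\mathbf x^0$ for all $j\in I$, and $\min_{j\in I}d_{jl}(t)>0$ for $0\le t\le T_c$ and every $l\in\{1,\dots,N\}\setminus I$. *)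

theory Defs
  imports "HOL-Analysis.Analysis" "HOL-Library.Extended_Real" "HOL-Library.Landau_Symbols"
begin

definition vortex_velocity ::
  "nat \<Rightarrow> (nat \<Rightarrow> int) \<Rightarrow> (nat \<Rightarrow> real^2) \<Rightarrow> nat \<Rightarrow> real^2" where
  "vortex_velocity N m X j =
     (2 * of_int (m j)) *\<^sub>R
       (\<Sum>k\<in>{1..N} - {j}. (of_int (m k) / (norm (X j - X k))\<^sup>2) *\<^sub>R (X j - X k))"

text \<open>
  A solution lives on the half-open interval from \<open>0\<close> up to a lifespan \<open>T\<close>, possibly infinite.
  The vortices have to stay distinct, since division by zero in HOL would otherwise
  give the right-hand side a spurious meaning. The equation is imposed for \<open>t > 0\<close> only;
  the initial data are attained continuously.
\<close>

definition vortex_solution ::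
  "nat \<Rightarrow> (nat \<Rightarrow> int) \<Rightarrow> (nat \<Rightarrow> real^2) \<Rightarrow> ereal \<Rightarrow> (nat \<Rightarrow> real \<Rightarrow> real^2) \<Rightarrow> bool" where
  "vortex_solution N m x0 T x \<longleftrightarrow>
     0 < T \<and>
     (\<forall>j\<in>{1..N}. x j 0 = x0 j) \<and>
     (\<forall>j\<in>{1..N}. continuous_on {t. 0 \<le> t \<and> ereal t < T} (x j)) \<and>
     (\<forall>t. 0 \<le> t \<and> ereal t < T \<longrightarrow> inj_on (\<lambda>j. x j t) {1..N}) \<and>
     (\<forall>j\<in>{1..N}. \<forall>t. 0 < t \<and> ereal t < T \<longrightarrow>
        (x j has_vector_derivative vortex_velocity N m (\<lambda>k. x k t) j) (at t))"

text \<open>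
  The solution of the initial value problem: a solution of which every other solution is a
  restriction. This says both that the lifespan \<open>T\<close> is maximal and that the solution is unique.
\<close>

definition the_vortex_solution ::
  "nat \<Rightarrow> (nat \<Rightarrow> int) \<Rightarrow> (nat \<Rightarrow> real^2) \<Rightarrow> ereal \<Rightarrow> (nat \<Rightarrow> real \<Rightarrow> real^2) \<Rightarrow> bool" where
  "the_vortex_solution N m x0 T x \<longleftrightarrow>
     vortex_solution N m x0 T x \<and>
     (\<forall>T' y. vortex_solution N m x0 T' y \<longrightarrow>
        T' \<le> T \<and> (\<forall>j\<in>{1..N}. \<forall>t. 0 \<le> t \<and> ereal t < T' \<longrightarrow> y j t = x j t))"

text \<open>
  The vortices in \<open>I\<close> collide at time \<open>Tc\<close> in the point \<open>p\<close>. The last condition refers to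
  positions at the collision time itself, where the differential equation is no longer
  meaningful; continuity on the closed interval makes these positions the limits of the
  trajectories as \<open>t\<close> tends to \<open>Tc\<close> from the left.
\<close>

definition collision_cluster_at ::
  "nat \<Rightarrow> (nat \<Rightarrow> real \<Rightarrow> real^2) \<Rightarrow> nat set \<Rightarrow> real \<Rightarrow> real^2 \<Rightarrow> bool" where
  "collision_cluster_at N x I Tc p \<longleftrightarrow>
     I \<subseteq> {1..N} \<and> 2 \<le> card I \<and> 0 < Tc \<and>
     (\<forall>j\<in>{1..N}. continuous_on {0..Tc} (x j)) \<and>
     (\<forall>t. 0 \<le> t \<and> t < Tc \<longrightarrow> (\<forall>j l. 1 \<le> j \<and> j < l \<and> l \<le> N \<longrightarrow> 0 < norm (x j t - x l t))) \<and>
     (\<forall>j\<in>I. (x j \<longlongrightarrow> p) (at_left Tc)) \<and>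
     (\<forall>l\<in>{1..N} - I. \<forall>t. 0 \<le> t \<and> t \<le> Tc \<longrightarrow> (\<forall>j\<in>I. 0 < norm (x j t - x l t)))"

definition ring_direction :: "nat \<Rightarrow> real \<Rightarrow> nat \<Rightarrow> real^2" where
  "ring_direction n \<theta>0 j =
     (let \<theta> = 2 * (real j - 1) * pi / real n + \<theta>0 in vector [cos \<theta>, sin \<theta>])"

end

theory Submission
  imports Defs
begin

text \<open>
  The rotational symmetry of the configuration reduces the system to the two squared radii:
  sums of \<open>1 / (z - w)\<close> over a ring are sums over roots of unity and give
  \<open>\<rho>1' = A - 4 n p / (1 - p)\<close> and \<open>\<rho>2' = A + 4 n / (1 - p)\<close>, where \<open>A = 2 (n - 3)\<close>,
  \<open>q = \<rho>1 / \<rho>2\<close> and \<open>p = q powr (n / 2)\<close>. Hence \<open>S = \<rho>1 + \<rho>2\<close> grows linearly with slope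
  \<open>8 n - 12\<close>, and in the logarithmic time \<open>ln S\<close> the ratio \<open>q\<close> obeys an autonomous scalar equation,
  solved by inverting a primitive. For \<open>n \<ge> 3\<close> this equation has exactly one equilibrium in
  \<open>[0, 1)\<close>, to which every solution tends; it is positive for \<open>n \<ge> 4\<close> and yields the two growth rates.
  For \<open>n = 3\<close> the equilibrium is \<open>0\<close>, and the limit of the inner radius comes from the conserved
  quantity \<open>1 / sqrt \<rho>1 + 1 / sqrt \<rho>2\<close>. For \<open>n = 2\<close> one has \<open>(\<rho>2 - \<rho>1)\<^sup>2 - 2 S\<^sup>2 = const\<close>, and
  \<open>\<rho>1\<close> vanishes in finite time. Uniqueness of solutions is Gronwall's inequality together with
  the exact Lipschitz identity for the inversion \<open>v / |v|\<^sup>2\<close>.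
\<close>

section \<open>Interactions within and between rings\<close>

text \<open>In complex coordinates the interaction \<open>v / |v|^2\<close> becomes the conjugate of
  \<open>1 / z\<close>, which turns ring sums into sums over roots of unity.\<close>

definition plane_of_complex :: "complex \<Rightarrow> real^2" where
  "plane_of_complex z = vector [Re z, Im z]"

lemma linear_plane_of_complex: "linear plane_of_complex"
  by (rule linearI) (auto simp: plane_of_complex_def vec_eq_iff forall_2)

lemmas plane_of_complex_linear =
  linear_add[OF linear_plane_of_complex]
  linear_diff[OF linear_plane_of_complex]
  linear_cmul[OF linear_plane_of_complex]
  linear_sum[OF linear_plane_of_complex]
  linear_0[OF linear_plane_of_complex]

lemma norm_plane_of_complex [simp]: "norm (plane_of_complex z) = norm z"
  by (simp add: plane_of_complex_def norm_vec_def L2_set_def sum_2 cmod_def)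

lemma ring_direction_eq_plane_of_complex:
  "ring_direction n \<theta>0 j = plane_of_complex (cis \<theta>0 * cis (2 * pi * (real j - 1) / real n))"
  by (simp add: ring_direction_def plane_of_complex_def Let_def cis_mult mult_ac add_ac)

text \<open>Rests on \<open>z * cnj z = |z|^2\<close>; at \<open>z = 0\<close> both sides vanish
  because \<open>inverse 0 = 0\<close>.\<close>

lemma scaleR_inverse_square_norm: "(a / (norm z)\<^sup>2) *\<^sub>R z = a *\<^sub>R cnj (inverse z)" for z :: complex
  by (cases "z = 0") (auto simp: complex_eq_iff cmod_def power2_eq_square)

section \<open>Sums over roots of unity\<close>

lemma sum_power_roots_unity:
  assumes "0 < m" "m < n"
  shows "(\<Sum>w | w ^ n = (1::complex). w ^ m) = 0"
proof -
  define c where "c = cis (2 * pi / real n)"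
  have n: "0 < n" using assms by auto
  have c: "c ^ n = 1"
    using n by (simp add: c_def Complex.DeMoivre)
  have "c ^ m \<noteq> 1"
  proof
    assume "c ^ m = 1"
    hence "cis (2 * pi * real m / real n) = cis (2 * pi * real 0 / real n)"
      by (simp add: c_def Complex.DeMoivre mult_ac)
    moreover have "inj_on (\<lambda>k. cis (2 * pi * real k / real n)) {..<n}"
      using Complex.bij_betw_roots_unity[OF n] by (auto simp: bij_betw_def)
    ultimately show False
      using assms n by (auto dest: inj_onD[where x = m and y = 0])
  qed
  have c0: "c \<noteq> 0" by (simp add: c_def)
  \<comment> \<open>Multiplication by \<open>c\<close> permutes the roots of unity, yet multiplies
    the sum by \<open>c ^ m\<close>, which is not 1; the sum is therefore 0.\<close>
  have "bij_betw (\<lambda>w. c * w) {w. w ^ n = 1} {w. w ^ n = 1}"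
    by (rule bij_betwI[where g = "\<lambda>w. w / c"]) (auto simp: power_mult_distrib power_divide c c0)
  from sum.reindex_bij_betw[OF this, of "\<lambda>w. w ^ m"]
  have "(\<Sum>w | w ^ n = 1. w ^ m) = c ^ m * (\<Sum>w | w ^ n = 1. w ^ m)"
    by (simp add: power_mult_distrib sum_distrib_left)
  with \<open>c ^ m \<noteq> 1\<close> show ?thesis by auto
qed

text \<open>Since \<open>(x * w) ^ n = x ^ n\<close>, a finite geometric series writes the summand
  as a polynomial in \<open>w\<close> over the fixed denominator \<open>1 - x ^ n\<close>. Summation
  over \<open>w\<close> kills every power except the zeroth.\<close>

lemma sum_inverse_one_minus_roots_unity:
  fixes x :: complex
  assumes "0 < n" "x ^ n \<noteq> 1"
  shows "(\<Sum>w | w ^ n = 1. inverse (1 - x * w)) = of_nat n / (1 - x ^ n)"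
proof -
  have eq: "inverse (1 - x * w) = (\<Sum>m<n. x ^ m * w ^ m) / (1 - x ^ n)" if "w ^ n = 1" for w
  proof -
    have "(x * w) ^ n = x ^ n" using that by (simp add: power_mult_distrib)
    hence *: "x * w \<noteq> 1" using assms by (metis power_one)
    have "(\<Sum>m<n. (x * w) ^ m) * (1 - x * w) = 1 - x ^ n"
      using one_diff_power_eq[of "x * w" n] \<open>(x * w) ^ n = x ^ n\<close> by (simp add: mult.commute)
    thus ?thesis using * assms
      by (simp add: power_mult_distrib divide_simps)
  qed
  have "(\<Sum>w | w ^ n = 1. inverse (1 - x * w)) = (\<Sum>w | w ^ n = 1. \<Sum>m<n. x ^ m * w ^ m) / (1 - x ^ n)"
    by (simp add: eq sum_divide_distrib)
  also have "(\<Sum>w | w ^ n = 1. \<Sum>m<n. x ^ m * w ^ m) = (\<Sum>m<n. x ^ m * (\<Sum>w | w ^ n = 1. w ^ m))"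
    by (subst sum.swap) (simp add: sum_distrib_left)
  also have "\<dots> = (\<Sum>m<n. if m = 0 then of_nat n else 0)"
    by (rule sum.cong) (use assms sum_power_roots_unity card_roots_unity_eq in auto)
  also have "\<dots> = of_nat n" using assms by simp
  finally show ?thesis .
qed

text \<open>On the unit circle \<open>1 / (1 - w)\<close> has real part 1/2. Conjugation permutes
  the nontrivial roots, so adding the conjugated sum gives twice the sum on one side and the number
  \<open>n - 1\<close> of roots on the other.\<close>

lemma sum_inverse_one_minus_nontrivial_roots_unity:
  assumes "0 < n"
  shows "(\<Sum>w\<in>{w::complex. w ^ n = 1} - {1}. inverse (1 - w)) = of_real ((real n - 1) / 2)"
proof -
  let ?W = "{w::complex. w ^ n = 1} - {1}"
  let ?s = "\<Sum>w\<in>?W. inverse (1 - w)"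
  have fin: "finite {w::complex. w ^ n = 1}" using assms by (intro finite_roots_unity) auto
  have card: "card ?W = n - 1"
    using fin assms by (simp add: card_roots_unity_eq)
  have "bij_betw cnj ?W ?W"
    by (rule bij_betwI[where g = cnj]) (auto simp flip: complex_cnj_power)
  from sum.reindex_bij_betw[OF this, of "\<lambda>w. inverse (1 - w)"]
  have "?s = cnj ?s" by simp
  hence "2 * ?s = ?s + cnj ?s" by simp
  also have "\<dots> = (\<Sum>w\<in>?W. inverse (1 - w) + inverse (1 - cnj w))"
    by (simp add: sum.distrib)
  also have "\<dots> = (\<Sum>w\<in>?W. 1)"
  proof (rule sum.cong)
    fix w assume w: "w \<in> ?W"
    hence "norm w = 1" using assms power_eq_1_iff[of w n] by auto
    hence "w * cnj w = 1" by (simp add: complex_norm_square[symmetric])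
    moreover have "w \<noteq> 1" "cnj w \<noteq> 1" using w by auto
    ultimately show "inverse (1 - w) + inverse (1 - cnj w) = 1"
      by (simp add: divide_simps) (simp add: algebra_simps)
  qed simp
  also have "\<dots> = of_nat (n - 1)" using card by simp
  also have "\<dots> = of_real (real n - 1)" using assms by (simp add: of_nat_diff)
  finally have "2 * ?s = of_real (real n - 1)" .
  moreover have "s = of_real (a / 2)" if "2 * s = of_real a" for s :: complex and a
    using that by (simp add: field_simps)
  ultimately show ?thesis by blast
qed

lemma bij_betw_ring_phase:
  assumes "0 < n"
  shows "bij_betw (\<lambda>k. cis (2 * pi * (real k - 1) / real n)) {1..n} {w. w ^ n = 1}"
proof -
  have "bij_betw (\<lambda>k. k - 1) {1..n} {..<n}"
    by (rule bij_betwI[where g = Suc]) auto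
  from bij_betw_trans[OF this Complex.bij_betw_roots_unity[OF assms]]
  show ?thesis
    by (rule bij_betw_cong[THEN iffD1, rotated]) (auto simp: of_nat_diff)
qed

text \<open>Rotational invariance: the ring may be turned so that the vortex under consideration has
  phase 1.\<close>

lemma sum_roots_unity_quotient:
  assumes "0 < n" "v ^ n = (1::complex)"
  shows "(\<Sum>w | w ^ n = 1. f (w / v)) = (\<Sum>w | w ^ n = 1. f w)"
proof -
  have "v \<noteq> 0" using assms by (auto simp: power_0_left)
  have "bij_betw (\<lambda>w. w / v) {w. w ^ n = 1} {w. w ^ n = 1}"
    by (rule bij_betwI[where g = "\<lambda>w. w * v"])
       (use assms \<open>v \<noteq> 0\<close> in \<open>auto simp: power_mult_distrib power_divide\<close>)
  from sum.reindex_bij_betw[OF this] show ?thesis .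
qed

section \<open>Forces exerted by a ring\<close>

lemma sum_ring_directions:
  assumes "2 \<le> n"
  shows "(\<Sum>k=1..n. ring_direction n \<theta>0 k) = 0"
proof -
  have "(\<Sum>k=1..n. cis (2 * pi * (real k - 1) / real n)) = \<Sum>{w. w ^ n = (1::complex)}"
    using assms by (intro sum.reindex_bij_betw bij_betw_ring_phase) auto
  also have "\<dots> = 0" using assms sum_roots_unity[of n] by simp
  finally show ?thesis
    by (simp add: ring_direction_eq_plane_of_complex flip: plane_of_complex_linear sum_distrib_left)
qed

lemma norm_ring_direction [simp]: "norm (ring_direction n \<theta>0 j) = 1"
  by (simp add: ring_direction_eq_plane_of_complex norm_mult)

lemma plane_of_complex_interaction:
  "(1 / (norm (plane_of_complex z - plane_of_complex w))\<^sup>2) *\<^sub>R (plane_of_complex z - plane_of_complex w) =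
     plane_of_complex (cnj (inverse (z - w)))"
  by (simp add: scaleR_inverse_square_norm flip: plane_of_complex_linear)

text \<open>Pulling \<open>r * u j\<close> out of every difference leaves \<open>1 - x * w\<close>
  with \<open>x = R / r\<close> and \<open>w\<close> ranging over all roots of unity. The final
  conjugation restores the direction, as \<open>u j\<close> has modulus 1. No order between
  \<open>r\<close> and \<open>R\<close> is assumed, so the lemma serves both rings.\<close>

lemma ring_interaction_between:
  assumes "0 < n" "j \<in> {1..n}" "0 < r" "0 < R" "r \<noteq> R"
  shows "(\<Sum>k=1..n. (1 / (norm (r *\<^sub>R ring_direction n \<theta>0 j - R *\<^sub>R ring_direction n \<theta>0 k))\<^sup>2) *\<^sub>R
            (r *\<^sub>R ring_direction n \<theta>0 j - R *\<^sub>R ring_direction n \<theta>0 k)) =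
         (real n * r ^ n / (r * (r ^ n - R ^ n))) *\<^sub>R ring_direction n \<theta>0 j"
proof -
  define \<omega> where "\<omega> = (\<lambda>k. cis (2 * pi * (real k - 1) / real n))"
  define u where "u = (\<lambda>k. cis \<theta>0 * \<omega> k)"
  have rd: "ring_direction n \<theta>0 k = plane_of_complex (u k)" for k
    by (simp add: ring_direction_eq_plane_of_complex u_def \<omega>_def)
  have bij: "bij_betw \<omega> {1..n} {w. w ^ n = 1}"
    unfolding \<omega>_def by (rule bij_betw_ring_phase[OF assms(1)])
  hence vn: "\<omega> j ^ n = 1" using assms(2) by (auto simp: bij_betw_def)
  have nz: "cis \<theta>0 \<noteq> 0" "\<omega> j \<noteq> 0" "u j \<noteq> 0" by (auto simp: u_def \<omega>_def)
  have norm_u: "u j * cnj (u j) = 1"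
    by (simp add: u_def \<omega>_def cis_cnj cis_mult)
  define x where "x = complex_of_real (R / r)"
  \<comment> \<open>A positive real whose \<open>n\<close>-th power is 1 equals 1, which
    \<open>r \<noteq> R\<close> excludes.\<close>
  have xn: "x ^ n \<noteq> 1"
  proof
    assume "x ^ n = 1"
    hence "complex_of_real ((R / r) ^ n) = 1" by (simp add: x_def)
    hence "(R / r) ^ n = 1" by (simp only: of_real_eq_1_iff)
    hence "norm (R / r) = 1" using power_eq_1_iff[of "R / r" n] assms(1) by blast
    thus False using assms by simp
  qed
  have "inverse (r *\<^sub>R u j - R *\<^sub>R u k) = inverse (r *\<^sub>R u j) * inverse (1 - x * (\<omega> k / \<omega> j))" for k
  proof -
    have "r *\<^sub>R u j - R *\<^sub>R u k = (r *\<^sub>R u j) * (1 - x * (\<omega> k / \<omega> j))"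
      using nz assms by (simp add: x_def u_def scaleR_conv_of_real field_simps)
    thus ?thesis by (simp only: inverse_mult_distrib)
  qed
  hence "(\<Sum>k=1..n. inverse (r *\<^sub>R u j - R *\<^sub>R u k)) =
      inverse (r *\<^sub>R u j) * (\<Sum>k=1..n. inverse (1 - x * (\<omega> k / \<omega> j)))"
    by (simp add: sum_distrib_left)
  also have "(\<Sum>k=1..n. inverse (1 - x * (\<omega> k / \<omega> j))) = (\<Sum>w | w ^ n = 1. inverse (1 - x * (w / \<omega> j)))"
    by (rule sum.reindex_bij_betw[OF bij])
  also have "\<dots> = (\<Sum>w | w ^ n = 1. inverse (1 - x * w))"
    by (rule sum_roots_unity_quotient[OF assms(1) vn])
  also have "\<dots> = of_nat n / (1 - x ^ n)"
    by (rule sum_inverse_one_minus_roots_unity[OF assms(1) xn])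
  also have "inverse (r *\<^sub>R u j) * \<dots> = (real n / (r * (1 - (R / r) ^ n))) *\<^sub>R inverse (u j)"
    by (simp add: x_def scaleR_conv_of_real field_simps)
  also have "real n / (r * (1 - (R / r) ^ n)) = real n * r ^ n / (r * (r ^ n - R ^ n))"
    using assms by (simp add: power_divide field_simps)
  finally have *: "(\<Sum>k=1..n. inverse (r *\<^sub>R u j - R *\<^sub>R u k)) =
    (real n * r ^ n / (r * (r ^ n - R ^ n))) *\<^sub>R inverse (u j)" .
  have "cnj (inverse (u j)) = u j"
    using norm_u nz by (simp add: field_simps)
  with arg_cong[OF *, of cnj]
  have "(\<Sum>k=1..n. cnj (inverse (r *\<^sub>R u j - R *\<^sub>R u k))) =
    (real n * r ^ n / (r * (r ^ n - R ^ n))) *\<^sub>R u j" by (simp add: scaleR_conv_of_real)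
  thus ?thesis
    unfolding rd linear_cmul[OF linear_plane_of_complex, symmetric] plane_of_complex_interaction
      linear_sum[OF linear_plane_of_complex, symmetric]
    by (simp only:)
qed

text \<open>The same factorization with equal radii; omitting the vortex itself becomes omitting the
  root 1.\<close>

lemma ring_interaction_within:
  assumes "0 < n" "j \<in> {1..n}" "0 < r"
  shows "(\<Sum>k\<in>{1..n} - {j}. (1 / (norm (r *\<^sub>R ring_direction n \<theta>0 j - r *\<^sub>R ring_direction n \<theta>0 k))\<^sup>2) *\<^sub>R
            (r *\<^sub>R ring_direction n \<theta>0 j - r *\<^sub>R ring_direction n \<theta>0 k)) =
         ((real n - 1) / (2 * r)) *\<^sub>R ring_direction n \<theta>0 j"
proof -
  define \<omega> where "\<omega> = (\<lambda>k. cis (2 * pi * (real k - 1) / real n))"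
  define u where "u = (\<lambda>k. cis \<theta>0 * \<omega> k)"
  have rd: "ring_direction n \<theta>0 k = plane_of_complex (u k)" for k
    by (simp add: ring_direction_eq_plane_of_complex u_def \<omega>_def)
  have bij: "bij_betw \<omega> {1..n} {w. w ^ n = 1}"
    unfolding \<omega>_def by (rule bij_betw_ring_phase[OF assms(1)])
  hence vn: "\<omega> j ^ n = 1" using assms(2) by (auto simp: bij_betw_def)
  have nz: "cis \<theta>0 \<noteq> 0" "\<omega> j \<noteq> 0" "u j \<noteq> 0" by (auto simp: u_def \<omega>_def)
  have norm_u: "u j * cnj (u j) = 1"
    by (simp add: u_def \<omega>_def cis_cnj cis_mult)
  have "bij_betw (\<lambda>w. w / \<omega> j) {w. w ^ n = 1} {w. w ^ n = 1}"
    by (rule bij_betwI[where g = "\<lambda>w. w * \<omega> j"])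
       (use vn nz in \<open>auto simp: power_mult_distrib power_divide\<close>)
  from bij_betw_trans[OF bij this]
  have bij': "bij_betw (\<lambda>k. \<omega> k / \<omega> j) {1..n} {w. w ^ n = 1}" by (simp add: o_def)
  have bij'': "bij_betw (\<lambda>k. \<omega> k / \<omega> j) ({1..n} - {j}) ({w. w ^ n = 1} - {1})"
    using bij_betw_DiffI[OF bij', of "{j}" "{1}"] assms(2) nz by simp
  have "inverse (r *\<^sub>R u j - r *\<^sub>R u k) = inverse (r *\<^sub>R u j) * inverse (1 - \<omega> k / \<omega> j)" for k
  proof -
    have "r *\<^sub>R u j - r *\<^sub>R u k = (r *\<^sub>R u j) * (1 - \<omega> k / \<omega> j)"
      using nz assms by (simp add: u_def scaleR_conv_of_real field_simps)
    thus ?thesis by (simp only: inverse_mult_distrib)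
  qed
  hence "(\<Sum>k\<in>{1..n} - {j}. inverse (r *\<^sub>R u j - r *\<^sub>R u k)) =
      inverse (r *\<^sub>R u j) * (\<Sum>k\<in>{1..n} - {j}. inverse (1 - \<omega> k / \<omega> j))"
    by (simp add: sum_distrib_left)
  also have "(\<Sum>k\<in>{1..n} - {j}. inverse (1 - \<omega> k / \<omega> j)) = (\<Sum>w\<in>{w. w ^ n = 1} - {1}. inverse (1 - w))"
    by (rule sum.reindex_bij_betw[OF bij''])
  also have "\<dots> = of_real ((real n - 1) / 2)"
    by (rule sum_inverse_one_minus_nontrivial_roots_unity[OF assms(1)])
  also have "inverse (r *\<^sub>R u j) * \<dots> = ((real n - 1) / (2 * r)) *\<^sub>R inverse (u j)"
    by (simp add: scaleR_conv_of_real field_simps)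
  finally have *: "(\<Sum>k\<in>{1..n} - {j}. inverse (r *\<^sub>R u j - r *\<^sub>R u k)) =
    ((real n - 1) / (2 * r)) *\<^sub>R inverse (u j)" .
  have "cnj (inverse (u j)) = u j"
    using norm_u nz by (simp add: field_simps)
  with arg_cong[OF *, of cnj]
  have "(\<Sum>k\<in>{1..n} - {j}. cnj (inverse (r *\<^sub>R u j - r *\<^sub>R u k))) =
    ((real n - 1) / (2 * r)) *\<^sub>R u j" by (simp add: scaleR_conv_of_real)
  thus ?thesis
    unfolding rd linear_cmul[OF linear_plane_of_complex, symmetric] plane_of_complex_interaction
      linear_sum[OF linear_plane_of_complex, symmetric]
    by (simp only:)
qed

section \<open>Double rings of vortices\<close>

lemma inj_on_ring_direction:
  assumes "0 < n"
  shows "inj_on (ring_direction n \<theta>0) {1..n}"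
proof -
  have "inj plane_of_complex"
    by (rule injI) (simp add: plane_of_complex_def vec_eq_iff forall_2 complex_eq_iff)
  hence "inj_on (plane_of_complex \<circ> (\<lambda>w. cis \<theta>0 * w) \<circ> (\<lambda>k. cis (2 * pi * (real k - 1) / real n))) {1..n}"
    by (intro comp_inj_on bij_betw_imp_inj_on[OF bij_betw_ring_phase[OF assms]])
       (auto intro: inj_on_subset inj_onI)
  moreover have "ring_direction n \<theta>0 = plane_of_complex \<circ> (\<lambda>w. cis \<theta>0 * w) \<circ> (\<lambda>k. cis (2 * pi * (real k - 1) / real n))"
    by (rule ext) (simp add: ring_direction_eq_plane_of_complex)
  ultimately show ?thesis by (simp only:)
qed

lemma ring_direction_nonzero [simp]: "ring_direction n \<theta>0 j \<noteq> 0"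
  using norm_ring_direction[of n \<theta>0 j] by fastforce

definition double_ring :: "nat \<Rightarrow> real \<Rightarrow> real \<Rightarrow> real \<Rightarrow> nat \<Rightarrow> real^2" where
  "double_ring n \<theta>0 r R j =
     (if j \<le> n then r *\<^sub>R ring_direction n \<theta>0 j
      else if j \<le> 2 * n then R *\<^sub>R ring_direction n \<theta>0 (j - n) else 0)"

text \<open>The second rule requires \<open>1 \<le> j\<close> because index \<open>n\<close> still
  belongs to the inner ring.\<close>

lemma double_ring_simps [simp]:
  "j \<le> n \<Longrightarrow> double_ring n \<theta>0 r R j = r *\<^sub>R ring_direction n \<theta>0 j"
  "1 \<le> j \<Longrightarrow> j \<le> n \<Longrightarrow> double_ring n \<theta>0 r R (n + j) = R *\<^sub>R ring_direction n \<theta>0 j"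
  "double_ring n \<theta>0 r R (Suc (2 * n)) = 0"
  by (auto simp: double_ring_def)

lemma double_ring_index_cases:
  assumes "j \<in> {1..2 * n + 1}"
  obtains (inner) "j \<in> {1..n}" | (outer) i where "j = n + i" "i \<in> {1..n}" | (center) "j = Suc (2 * n)"
proof -
  consider "j \<le> n" | "n < j" "j \<le> 2 * n" | "j = Suc (2 * n)" using assms by fastforce
  thus thesis
  proof cases
    case 1 thus thesis using assms inner by simp
  next
    case 2
    hence "j = n + (j - n)" "j - n \<in> {1..n}" by auto
    thus thesis by (rule outer)
  next
    case 3 thus thesis using center by simp
  qed
qed

text \<open>The norm of a position tells the inner ring, the outer ring and the center apart; within
  a ring the directions are distinct.\<close>

lemma inj_on_double_ring:
  assumes "0 < n" "0 < r" "r < R"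
  shows "inj_on (double_ring n \<theta>0 r R) {1..2 * n + 1}"
proof (rule inj_onI)
  fix j k assume j: "j \<in> {1..2 * n + 1}" and k: "k \<in> {1..2 * n + 1}"
    and eq: "double_ring n \<theta>0 r R j = double_ring n \<theta>0 r R k"
  note inj = inj_on_ring_direction[OF assms(1), of \<theta>0]
  have norm_eq: "(if j \<le> n then r else if j \<le> 2 * n then R else 0) =
      (if k \<le> n then r else if k \<le> 2 * n then R else 0)"
    using arg_cong[OF eq, of norm] assms by (simp add: double_ring_def split: if_splits)
  show "j = k"
    using j
  proof (cases rule: double_ring_index_cases)
    case inner
    note J = this
    show ?thesis using k
      by (cases rule: double_ring_index_cases)
         (use J eq norm_eq assms in \<open>auto dest: inj_onD[OF inj]\<close>)
  next
    case (outer i)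
    note J = this
    show ?thesis using k
      by (cases rule: double_ring_index_cases)
         (use J eq norm_eq assms in \<open>auto dest: inj_onD[OF inj]\<close>)
  next
    case center
    note J = this
    show ?thesis using k
      by (cases rule: double_ring_index_cases)
         (use J eq norm_eq assms in \<open>auto dest: inj_onD[OF inj]\<close>)
  qed
qed

text \<open>The self-interaction term is 0, being a multiple of \<open>X j - X j\<close>. The full
  index range then splits into the two rings and the center.\<close>

lemma vortex_velocity_eq_full_sum:
  assumes "j \<in> {1..N}"
  shows "vortex_velocity N m X j =
           (2 * of_int (m j)) *\<^sub>R (\<Sum>k=1..N. (of_int (m k) / (norm (X j - X k))\<^sup>2) *\<^sub>R (X j - X k))"
  unfolding vortex_velocity_def using assms by (simp add: sum.remove[where x = j])

lemma sum_split_two_blocks_and_last: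
  fixes f :: "nat \<Rightarrow> 'a :: comm_monoid_add"
  shows "(\<Sum>k=1..2 * n + 1. f k) = (\<Sum>k=1..n. f k) + (\<Sum>k=1..n. f (n + k)) + f (Suc (2 * n))"
proof -
  have "(\<Sum>k=1..2 * n + 1. f k) = (\<Sum>k=1..n + n. f k) + f (Suc (2 * n))"
    by (simp add: mult_2)
  also have "(\<Sum>k=1..n + n. f k) = (\<Sum>k=1..n. f k) + (\<Sum>k=n+1..n+n. f k)"
    by (rule sum.ub_add_nat) simp
  also have "(\<Sum>k=n+1..n+n. f k) = (\<Sum>k=1..n. f (n + k))"
    using sum.shift_bounds_cl_nat_ivl[of f 1 n n] by (simp add: add.commute)
  finally show ?thesis .
qed

section \<open>Velocities in a double-ring configuration\<close>

context
  fixes n :: nat and m :: "nat \<Rightarrow> int" and m0 :: int and \<theta>0 r R :: real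
  assumes n: "2 \<le> n" and m0: "m0 \<in> {1, -1}" and m_center: "m (2 * n + 1) = - m0"
    and m_rings: "\<forall>j\<in>{1..2*n}. m j = m0" and r: "0 < r" and rR: "r < R"
begin

private lemma m_sq: "real_of_int m0 * real_of_int m0 = 1"
  using m0 by auto

text \<open>Both rings carry the charge \<open>m0\<close> and the center \<open>- m0\<close>, so
  \<open>m0\<close> factors out and the central vortex contributes with a minus sign.\<close>

private lemma velocity_sum:
  assumes "j \<in> {1..2*n+1}"
  shows "vortex_velocity (2*n+1) m (double_ring n \<theta>0 r R) j =
    (2 * of_int (m j) * of_int m0) *\<^sub>R
      ((\<Sum>k=1..n. (1 / (norm (double_ring n \<theta>0 r R j - r *\<^sub>R ring_direction n \<theta>0 k))\<^sup>2) *\<^sub>R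
          (double_ring n \<theta>0 r R j - r *\<^sub>R ring_direction n \<theta>0 k)) +
       (\<Sum>k=1..n. (1 / (norm (double_ring n \<theta>0 r R j - R *\<^sub>R ring_direction n \<theta>0 k))\<^sup>2) *\<^sub>R
          (double_ring n \<theta>0 r R j - R *\<^sub>R ring_direction n \<theta>0 k)) -
       (1 / (norm (double_ring n \<theta>0 r R j))\<^sup>2) *\<^sub>R double_ring n \<theta>0 r R j)"
proof -
  have 1: "(\<Sum>k=1..n. (of_int (m k) / (norm (X - double_ring n \<theta>0 r R k))\<^sup>2) *\<^sub>R (X - double_ring n \<theta>0 r R k)) =
    of_int m0 *\<^sub>R (\<Sum>k=1..n. (1 / (norm (X - r *\<^sub>R ring_direction n \<theta>0 k))\<^sup>2) *\<^sub>R (X - r *\<^sub>R ring_direction n \<theta>0 k))"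
    for X :: "real^2"
    unfolding scaleR_sum_right using m_rings by (intro sum.cong) auto
  have 2: "(\<Sum>k=1..n. (of_int (m (n+k)) / (norm (X - double_ring n \<theta>0 r R (n+k)))\<^sup>2) *\<^sub>R (X - double_ring n \<theta>0 r R (n+k))) =
    of_int m0 *\<^sub>R (\<Sum>k=1..n. (1 / (norm (X - R *\<^sub>R ring_direction n \<theta>0 k))\<^sup>2) *\<^sub>R (X - R *\<^sub>R ring_direction n \<theta>0 k))"
    for X :: "real^2"
    unfolding scaleR_sum_right using m_rings by (intro sum.cong) auto
  show ?thesis
    unfolding vortex_velocity_eq_full_sum[OF assms] sum_split_two_blocks_and_last 1 2
    using m_center by (simp add: scaleR_add_right scaleR_diff_right)
qed

text \<open>For a ring vortex the charge factor is \<open>m0 * m0 = 1\<close>. Its own ring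
  contributes \<open>(n - 1) / r\<close> and the center \<open>- 2 / r\<close>, which combine to
  \<open>(n - 3) / r\<close>; the remaining term comes from the outer ring.\<close>

lemma velocity_inner_ring:
  assumes j: "j \<in> {1..n}"
  shows "vortex_velocity (2*n+1) m (double_ring n \<theta>0 r R) j =
    ((real n - 3) / r + 2 * real n * r ^ n / (r * (r ^ n - R ^ n))) *\<^sub>R ring_direction n \<theta>0 j"
proof -
  have n0: "0 < n" using n by simp
  \<comment> \<open>The full sum occurring in \<open>velocity_sum\<close> includes
    \<open>k = j\<close>, a zero term that is absent from
    \<open>ring_interaction_within\<close>.\<close>
  have w: "(\<Sum>k=1..n. (1 / (norm (r *\<^sub>R ring_direction n \<theta>0 j - r *\<^sub>R ring_direction n \<theta>0 k))\<^sup>2) *\<^sub>R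
            (r *\<^sub>R ring_direction n \<theta>0 j - r *\<^sub>R ring_direction n \<theta>0 k)) =
         ((real n - 1) / (2 * r)) *\<^sub>R ring_direction n \<theta>0 j"
    by (subst ring_interaction_within[OF n0 j r, of \<theta>0, symmetric], rule sum.mono_neutral_right) auto
  have j': "j \<le> n" "j \<in> {1..2*n+1}" "m j = m0" using j m_rings by auto
  show ?thesis
    unfolding velocity_sum[OF j'(2)] double_ring_simps(1)[OF j'(1)] w j'(3)
      ring_interaction_between[OF n0 j r less_trans[OF r rR] less_imp_neq[OF rR]]
    using r m_sq
    by (simp add: mult.assoc power2_eq_square flip: scaleR_add_left scaleR_diff_left)
       (simp add: field_simps)
qed

lemma velocity_outer_ring:
  assumes j: "j \<in> {1..n}"
  shows "vortex_velocity (2*n+1) m (double_ring n \<theta>0 r R) (n + j) =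
    ((real n - 3) / R + 2 * real n * R ^ n / (R * (R ^ n - r ^ n))) *\<^sub>R ring_direction n \<theta>0 j"
proof -
  have n0: "0 < n" using n by simp
  have R: "0 < R" using r rR by simp
  have w: "(\<Sum>k=1..n. (1 / (norm (R *\<^sub>R ring_direction n \<theta>0 j - R *\<^sub>R ring_direction n \<theta>0 k))\<^sup>2) *\<^sub>R
            (R *\<^sub>R ring_direction n \<theta>0 j - R *\<^sub>R ring_direction n \<theta>0 k)) =
         ((real n - 1) / (2 * R)) *\<^sub>R ring_direction n \<theta>0 j"
    by (subst ring_interaction_within[OF n0 j R, of \<theta>0, symmetric], rule sum.mono_neutral_right) auto
  have j': "1 \<le> j" "j \<le> n" "n + j \<in> {1..2*n+1}" "m (n + j) = m0" using j m_rings by auto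
  show ?thesis
    unfolding velocity_sum[OF j'(3)] double_ring_simps(2)[OF j'(1,2)] w j'(4)
      ring_interaction_between[OF n0 j R r less_imp_neq[OF rR, symmetric]]
    using R m_sq
    by (simp add: mult.assoc power2_eq_square flip: scaleR_add_left scaleR_diff_left)
       (simp add: field_simps)
qed

text \<open>Seen from the origin, all vortices of a ring are equally far, so their combined force is
  a multiple of the sum of the directions, which is 0.\<close>

lemma velocity_center: "vortex_velocity (2*n+1) m (double_ring n \<theta>0 r R) (2 * n + 1) = 0"
proof -
  have z: "(\<Sum>k=1..n. (1 / (norm (0 - a *\<^sub>R ring_direction n \<theta>0 k))\<^sup>2) *\<^sub>R (0 - a *\<^sub>R ring_direction n \<theta>0 k)) = 0" for a
  proof -
    have "(\<Sum>k=1..n. (1 / (norm (0 - a *\<^sub>R ring_direction n \<theta>0 k))\<^sup>2) *\<^sub>R (0 - a *\<^sub>R ring_direction n \<theta>0 k)) =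
      (- (a / a\<^sup>2)) *\<^sub>R (\<Sum>k=1..n. ring_direction n \<theta>0 k)"
      by (simp add: scaleR_sum_right sum_negf)
    thus ?thesis by (simp only: sum_ring_directions[OF n] scaleR_zero_right)
  qed
  have j: "2 * n + 1 \<in> {1..2*n+1}" "double_ring n \<theta>0 r R (2 * n + 1) = 0" by simp_all
  show ?thesis unfolding velocity_sum[OF j(1)] j(2) z by simp
qed

end

text \<open>The ring vortices move radially, so the vortex system reduces to the velocity formulas
  for the two radii. The hypotheses state these for the squared radii, by
  \<open>\<rho>' = 2 r r'\<close>; positivity permits differentiating the square roots.\<close>

lemma double_ring_vortex_solution:
  fixes \<rho>1 \<rho>2 :: "real \<Rightarrow> real"
  assumes n: "2 \<le> n" and m: "m0 \<in> {1, -1}" "m (2 * n + 1) = - m0" "\<forall>j\<in>{1..2*n}. m j = m0"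
    and T: "0 < T"
    and pos: "\<And>t. 0 \<le> t \<Longrightarrow> ereal t < T \<Longrightarrow> 0 < \<rho>1 t \<and> \<rho>1 t < \<rho>2 t"
    and cont: "continuous_on {t. 0 \<le> t \<and> ereal t < T} \<rho>1" "continuous_on {t. 0 \<le> t \<and> ereal t < T} \<rho>2"
    and deriv1: "\<And>t. 0 < t \<Longrightarrow> ereal t < T \<Longrightarrow>
      (\<rho>1 has_real_derivative 2 * (real n - 3) - 4 * real n * sqrt (\<rho>1 t) ^ n / (sqrt (\<rho>2 t) ^ n - sqrt (\<rho>1 t) ^ n)) (at t)"
    and deriv2: "\<And>t. 0 < t \<Longrightarrow> ereal t < T \<Longrightarrow>
      (\<rho>2 has_real_derivative 2 * (real n - 3) + 4 * real n * sqrt (\<rho>2 t) ^ n / (sqrt (\<rho>2 t) ^ n - sqrt (\<rho>1 t) ^ n)) (at t)"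
    and init: "\<And>j. j \<in> {1..2*n+1} \<Longrightarrow> x0 j = double_ring n \<theta>0 (sqrt (\<rho>1 0)) (sqrt (\<rho>2 0)) j"
  shows "vortex_solution (2*n+1) m x0 T (\<lambda>j t. double_ring n \<theta>0 (sqrt (\<rho>1 t)) (sqrt (\<rho>2 t)) j)"
  unfolding vortex_solution_def
proof (intro conjI ballI allI impI)
  fix j assume "j \<in> {1..2*n+1}"
  show "continuous_on {t. 0 \<le> t \<and> ereal t < T} (\<lambda>t. double_ring n \<theta>0 (sqrt (\<rho>1 t)) (sqrt (\<rho>2 t)) j)"
    unfolding double_ring_def
    by (cases "j \<le> n"; cases "j \<le> 2 * n") (auto intro!: continuous_intros cont)
next
  fix t assume "0 \<le> t \<and> ereal t < T"
  with pos[of t] n show "inj_on (double_ring n \<theta>0 (sqrt (\<rho>1 t)) (sqrt (\<rho>2 t))) {1..2 * n + 1}"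
    by (intro inj_on_double_ring) auto
next
  fix j t assume j: "j \<in> {1..2*n+1}" and t: "0 < t \<and> ereal t < T"
  let ?r = "sqrt (\<rho>1 t)" and ?R = "sqrt (\<rho>2 t)"
  have p: "0 < \<rho>1 t" "\<rho>1 t < \<rho>2 t" using pos[of t] t by auto
  hence rR: "0 < ?r" "?r < ?R" by auto
  have ne: "?r ^ n < ?R ^ n" using rR n by (intro power_strict_mono) auto
  have d1: "((\<lambda>t. sqrt (\<rho>1 t)) has_real_derivative
      (real n - 3) / ?r + 2 * real n * ?r ^ n / (?r * (?r ^ n - ?R ^ n))) (at t)"
  proof -
    have "((\<lambda>t. sqrt (\<rho>1 t)) has_real_derivative inverse ?r / 2 *
       (2 * (real n - 3) - 4 * real n * ?r ^ n / (?R ^ n - ?r ^ n))) (at t)"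
      using DERIV_chain2[OF DERIV_real_sqrt[OF p(1)] deriv1[of t]] t by simp
    moreover have "inverse ?r / 2 * (2 * (real n - 3) - 4 * real n * ?r ^ n / (?R ^ n - ?r ^ n)) =
       (real n - 3) / ?r + 2 * real n * ?r ^ n / (?r * (?r ^ n - ?R ^ n))"
      using rR ne by (simp add: divide_simps) (simp add: algebra_simps)
    ultimately show ?thesis by (simp only:)
  qed
  have d2: "((\<lambda>t. sqrt (\<rho>2 t)) has_real_derivative
      (real n - 3) / ?R + 2 * real n * ?R ^ n / (?R * (?R ^ n - ?r ^ n))) (at t)"
  proof -
    have "((\<lambda>t. sqrt (\<rho>2 t)) has_real_derivative inverse ?R / 2 *
       (2 * (real n - 3) + 4 * real n * ?R ^ n / (?R ^ n - ?r ^ n))) (at t)"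
      using DERIV_chain2[OF DERIV_real_sqrt deriv2[of t]] t p by simp
    moreover have "inverse ?R / 2 * (2 * (real n - 3) + 4 * real n * ?R ^ n / (?R ^ n - ?r ^ n)) =
       (real n - 3) / ?R + 2 * real n * ?R ^ n / (?R * (?R ^ n - ?r ^ n))"
      using rR ne by (simp add: divide_simps) (simp add: algebra_simps)
    ultimately show ?thesis by (simp only:)
  qed
  note vel = velocity_inner_ring[OF n m rR] velocity_outer_ring[OF n m rR] velocity_center[OF n m rR]
  show "((\<lambda>t. double_ring n \<theta>0 (sqrt (\<rho>1 t)) (sqrt (\<rho>2 t)) j) has_vector_derivative
          vortex_velocity (2*n+1) m (\<lambda>k. double_ring n \<theta>0 ?r ?R k) j) (at t)"
    using j
  proof (cases rule: double_ring_index_cases)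
    case inner
    note J = this
    show ?thesis
      using has_vector_derivative_scaleR[OF d1 has_vector_derivative_const[of "ring_direction n \<theta>0 j"]] J
      by (simp add: vel(1)[simplified] )
  next
    case (outer i)
    note J = this
    show ?thesis
      using has_vector_derivative_scaleR[OF d2 has_vector_derivative_const[of "ring_direction n \<theta>0 i"]] J
      by (simp add: vel(2)[simplified] )
  next
    case center
    thus ?thesis using vel(3) by simp
  qed
qed (use T init in auto)

section \<open>Uniqueness and maximality\<close>

text \<open>The weight \<open>exp (- C * s)\<close> turns the differential inequality into
  monotonicity. Derivatives are asked for on the open interval only, as the vortex equation is
  imposed for positive times only.\<close>

lemma gronwall_zero:
  fixes f f' :: "real \<Rightarrow> real"
  assumes "0 \<le> t" and cont: "continuous_on {0..t} f" and "f 0 \<le> 0"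
    and deriv: "\<And>s. 0 < s \<Longrightarrow> s < t \<Longrightarrow> (f has_real_derivative f' s) (at s)"
    and bound: "\<And>s. 0 < s \<Longrightarrow> s < t \<Longrightarrow> f' s \<le> C * f s"
  shows "f t \<le> 0"
proof -
  let ?g = "\<lambda>s. f s * exp (- C * s)"
  have "?g t \<le> ?g 0"
  proof (rule DERIV_nonpos_imp_decreasing_open[OF \<open>0 \<le> t\<close>])
    fix s assume s: "0 < s" "s < t"
    have "(?g has_real_derivative (f' s - C * f s) * exp (- C * s)) (at s)"
      using deriv[OF s] by (auto intro!: derivative_eq_intros simp: algebra_simps)
    moreover have "(f' s - C * f s) * exp (- C * s) \<le> 0"
      using bound[OF s] by (intro mult_nonpos_nonneg) auto
    ultimately show "\<exists>y. DERIV ?g s :> y \<and> y \<le> 0" by blast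
  next
    show "continuous_on {0..t} ?g" by (intro continuous_intros cont)
  qed
  also have "?g 0 \<le> 0" using \<open>f 0 \<le> 0\<close> by simp
  finally show ?thesis by (simp add: mult_le_0_iff)
qed

text \<open>After squaring, both sides equal
  \<open>(|v|^2 + |w|^2 - 2 v \<bullet> w) / (|v| |w|)^2\<close>. The identity makes the interaction
  Lipschitz away from collisions.\<close>

lemma norm_diff_inversion:
  fixes v w :: "'a :: real_inner"
  assumes "v \<noteq> 0" "w \<noteq> 0"
  shows "norm ((1 / (norm v)\<^sup>2) *\<^sub>R v - (1 / (norm w)\<^sup>2) *\<^sub>R w) = norm (v - w) / (norm v * norm w)"
proof (rule power2_eq_imp_eq)
  have sq: "(norm (x - y))\<^sup>2 = (norm x)\<^sup>2 + (norm y)\<^sup>2 - 2 * (x \<bullet> y)" for x y :: 'a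
    by (simp add: power2_norm_eq_inner inner_diff inner_commute)
  show "(norm ((1 / (norm v)\<^sup>2) *\<^sub>R v - (1 / (norm w)\<^sup>2) *\<^sub>R w))\<^sup>2 =
    (norm (v - w) / (norm v * norm w))\<^sup>2"
  proof -
    let ?a = "norm v" and ?b = "norm w"
    have "(norm ((1 / ?a\<^sup>2) *\<^sub>R v - (1 / ?b\<^sup>2) *\<^sub>R w))\<^sup>2 =
        (1 / ?a\<^sup>2)\<^sup>2 * ?a\<^sup>2 + (1 / ?b\<^sup>2)\<^sup>2 * ?b\<^sup>2 - 2 * ((1 / ?a\<^sup>2) * ((1 / ?b\<^sup>2) * (v \<bullet> w)))"
      unfolding sq by (simp add: power_mult_distrib power_divide)
    also have "\<dots> = (?a\<^sup>2 + ?b\<^sup>2 - 2 * (v \<bullet> w)) / (?a * ?b)\<^sup>2"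
      using assms by (simp add: field_simps power2_eq_square)
    finally show ?thesis by (simp add: sq power_divide)
  qed
qed auto

section \<open>Lipschitz estimate for the velocity field\<close>

definition well_separated :: "nat \<Rightarrow> real \<Rightarrow> (nat \<Rightarrow> 'a::real_normed_vector) \<Rightarrow> bool" where
  "well_separated N \<delta> X \<longleftrightarrow> (\<forall>j\<in>{1..N}. \<forall>k\<in>{1..N} - {j}. \<delta> \<le> norm (X j - X k))"

text \<open>Each of at most \<open>N\<close> interactions changes by at most
  \<open>M * (2 * d / \<delta>^2)\<close>, since a difference vector is displaced by at most
  \<open>2 * d\<close>. The outer factor \<open>2 * m j\<close> contributes another
  \<open>2 * M\<close>.\<close>

lemma norm_vortex_velocity_diff_le:
  assumes "0 < \<delta>" and j: "j \<in> {1..N}" and "well_separated N \<delta> X" "well_separated N \<delta> Y"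
    and M: "\<And>k. k \<in> {1..N} \<Longrightarrow> \<bar>real_of_int (m k)\<bar> \<le> M"
    and D: "\<And>k. k \<in> {1..N} \<Longrightarrow> norm (X k - Y k) \<le> d"
  shows "norm (vortex_velocity N m X j - vortex_velocity N m Y j) \<le> 4 * M\<^sup>2 * real N / \<delta>\<^sup>2 * d"
proof -
  have M0: "0 \<le> M" using M[OF j] by linarith
  have d0: "0 \<le> d" using D[OF j] norm_ge_zero order_trans by blast
  define K where "K = (\<lambda>v :: real^2. (1 / (norm v)\<^sup>2) *\<^sub>R v)"
  have V: "vortex_velocity N m Z j = (2 * of_int (m j)) *\<^sub>R (\<Sum>k\<in>{1..N} - {j}. of_int (m k) *\<^sub>R K (Z j - Z k))" for Z
    by (simp add: vortex_velocity_def K_def)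
  have term_le: "norm (of_int (m k) *\<^sub>R (K (X j - X k) - K (Y j - Y k))) \<le> M * (2 * d / \<delta>\<^sup>2)"
    if k: "k \<in> {1..N} - {j}" for k
  proof -
    have sep: "\<delta> \<le> norm (X j - X k)" "\<delta> \<le> norm (Y j - Y k)"
      using assms(3,4) j k by (auto simp: well_separated_def)
    hence nz: "X j - X k \<noteq> 0" "Y j - Y k \<noteq> 0" using \<open>0 < \<delta>\<close> by auto
    have "norm (K (X j - X k) - K (Y j - Y k)) =
        norm ((X j - X k) - (Y j - Y k)) / (norm (X j - X k) * norm (Y j - Y k))"
      unfolding K_def by (rule norm_diff_inversion[OF nz])
    also have "\<dots> \<le> (2 * d) / (\<delta> * \<delta>)"
    proof (rule frac_le)
      have "(X j - X k) - (Y j - Y k) = (X j - Y j) - (X k - Y k)" by simp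
      hence "norm ((X j - X k) - (Y j - Y k)) \<le> norm (X j - Y j) + norm (X k - Y k)"
        by (metis norm_triangle_ineq4)
      also have "\<dots> \<le> d + d" using D j k by (intro add_mono) auto
      finally show "norm ((X j - X k) - (Y j - Y k)) \<le> 2 * d" by simp
      show "\<delta> * \<delta> \<le> norm (X j - X k) * norm (Y j - Y k)"
        using sep \<open>0 < \<delta>\<close> by (intro mult_mono) auto
    qed (use d0 \<open>0 < \<delta>\<close> in auto)
    finally have "norm (K (X j - X k) - K (Y j - Y k)) \<le> 2 * d / \<delta>\<^sup>2" by (simp add: power2_eq_square)
    thus ?thesis unfolding norm_scaleR using M[of k] k M0 by (intro mult_mono) auto
  qed
  have "vortex_velocity N m X j - vortex_velocity N m Y j =
      (2 * of_int (m j)) *\<^sub>R (\<Sum>k\<in>{1..N} - {j}. of_int (m k) *\<^sub>R (K (X j - X k) - K (Y j - Y k)))"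
    unfolding V by (simp add: scaleR_diff_right sum_subtractf)
  also have "norm \<dots> = 2 * \<bar>of_int (m j)\<bar> * norm (\<Sum>k\<in>{1..N} - {j}. of_int (m k) *\<^sub>R (K (X j - X k) - K (Y j - Y k)))"
    by (simp add: abs_mult)
  also have "\<dots> \<le> 2 * M * (real (card ({1..N} - {j})) * (M * (2 * d / \<delta>\<^sup>2)))"
  proof (intro mult_mono)
    show "norm (\<Sum>k\<in>{1..N} - {j}. of_int (m k) *\<^sub>R (K (X j - X k) - K (Y j - Y k)))
        \<le> real (card ({1..N} - {j})) * (M * (2 * d / \<delta>\<^sup>2))"
      by (intro sum_norm_bound term_le)
  qed (use M[OF j] M0 in auto)
  also have "\<dots> \<le> 2 * M * (real N * (M * (2 * d / \<delta>\<^sup>2)))"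
  proof (intro mult_left_mono mult_right_mono)
    show "real (card ({1..N} - {j})) \<le> real N"
      using card_mono[of "{1..N}" "{1..N} - {j}"] by simp
  qed (use M0 d0 in auto)
  finally show ?thesis by (simp add: power2_eq_square field_simps)
qed

text \<open>Compactness of \<open>{0..t}\<close> gives a positive minimum for each of the finitely
  many pairwise distances.\<close>

lemma exists_separation:
  fixes x :: "nat \<Rightarrow> real \<Rightarrow> 'a :: real_normed_vector"
  assumes cont: "\<And>j. j \<in> {1..N} \<Longrightarrow> continuous_on {0..t} (x j)"
    and inj: "\<And>s. s \<in> {0..t} \<Longrightarrow> inj_on (\<lambda>j. x j s) {1..N}"
  shows "\<exists>\<delta>>0. \<forall>s\<in>{0..t}. well_separated N \<delta> (\<lambda>j. x j s)"
proof -
  have "\<exists>\<delta>>0. \<forall>s\<in>{0..t}. \<delta> \<le> norm (x (fst p) s - x (snd p) s)"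
    if p: "p \<in> {p \<in> {1..N} \<times> {1..N}. fst p \<noteq> snd p}" for p
  proof (cases "{0..t} = {}")
    case True
    thus ?thesis by (intro exI[of _ 1]) simp
  next
    case False
    have "continuous_on {0..t} (\<lambda>s. norm (x (fst p) s - x (snd p) s))"
      using p by (auto intro!: continuous_intros cont)
    from continuous_attains_inf[OF compact_Icc False this] obtain s where
      s: "s \<in> {0..t}" "\<And>r. r \<in> {0..t} \<Longrightarrow> norm (x (fst p) s - x (snd p) s) \<le> norm (x (fst p) r - x (snd p) r)"
      by blast
    have "x (fst p) s \<noteq> x (snd p) s" using inj[OF s(1)] p by (auto dest: inj_onD)
    thus ?thesis using s by (intro exI[of _ "norm (x (fst p) s - x (snd p) s)"]) auto
  qed
  hence "\<forall>p\<in>{p \<in> {1..N} \<times> {1..N}. fst p \<noteq> snd p}. \<exists>\<delta>. 0 < \<delta> \<and>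
      (\<forall>s\<in>{0..t}. \<delta> \<le> norm (x (fst p) s - x (snd p) s))" by blast
  from bchoice[OF this] obtain \<delta> where \<delta>: "\<forall>p\<in>{p \<in> {1..N} \<times> {1..N}. fst p \<noteq> snd p}.
      0 < \<delta> p \<and> (\<forall>s\<in>{0..t}. \<delta> p \<le> norm (x (fst p) s - x (snd p) s))" ..
  \<comment> \<open>The extra element 1 keeps the set nonempty when there is no pair of distinct
    indices.\<close>
  let ?D = "insert 1 (\<delta> ` {p \<in> {1..N} \<times> {1..N}. fst p \<noteq> snd p})"
  have fin: "finite ?D" by simp
  have "0 < Min ?D" using \<delta> fin by (subst Min_gr_iff) auto
  moreover have "Min ?D \<le> norm (x j s - x k s)" if "j \<in> {1..N}" "k \<in> {1..N} - {j}" "s \<in> {0..t}" for j k s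
  proof -
    have p: "(j, k) \<in> {p \<in> {1..N} \<times> {1..N}. fst p \<noteq> snd p}" using that by auto
    hence "Min ?D \<le> \<delta> (j, k)" by (intro Min_le[OF fin]) blast
    thus ?thesis using bspec[OF \<delta> p] that by force
  qed
  ultimately show ?thesis unfolding well_separated_def by blast
qed

text \<open>Up to time \<open>t\<close> both solutions stay uniformly separated, so the velocity
  field is Lipschitz along them, and Gronwall's inequality applies to the sum of the squared
  distances.\<close>

lemma vortex_solution_unique:
  assumes x: "vortex_solution N m x0 T x" and y: "vortex_solution N m x0 T' y"
    and t: "0 \<le> t" "ereal t < T" "ereal t < T'" and j: "j \<in> {1..N}"
  shows "y j t = x j t"
proof -
  have sub: "{0..t} \<subseteq> {s. 0 \<le> s \<and> ereal s < T}" "{0..t} \<subseteq> {s. 0 \<le> s \<and> ereal s < T'}"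
    using t by (auto intro: le_less_trans[where y = "ereal t"])
  have cx: "continuous_on {0..t} (x k)" and cy: "continuous_on {0..t} (y k)" if "k \<in> {1..N}" for k
    using x y sub that unfolding vortex_solution_def by (blast intro: continuous_on_subset)+
  have ix: "inj_on (\<lambda>j. x j s) {1..N}" and iy: "inj_on (\<lambda>j. y j s) {1..N}" if "s \<in> {0..t}" for s
    using x y sub that unfolding vortex_solution_def by blast+
  have dx: "(x k has_vector_derivative vortex_velocity N m (\<lambda>k. x k s) k) (at s)"
    and dy: "(y k has_vector_derivative vortex_velocity N m (\<lambda>k. y k s) k) (at s)"
    if "k \<in> {1..N}" "0 < s" "s < t" for k s
  proof -
    have "s \<in> {0..t}" using that by simp
    hence "0 \<le> s" "ereal s < T" "ereal s < T'" using sub by blast+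
    thus "(x k has_vector_derivative vortex_velocity N m (\<lambda>k. x k s) k) (at s)"
      and "(y k has_vector_derivative vortex_velocity N m (\<lambda>k. y k s) k) (at s)"
      using x y that unfolding vortex_solution_def by blast+
  qed
  obtain \<delta>1 where \<delta>1: "0 < \<delta>1" "\<And>s. s \<in> {0..t} \<Longrightarrow> well_separated N \<delta>1 (\<lambda>j. x j s)"
    using exists_separation[OF cx ix] by blast
  obtain \<delta>2 where \<delta>2: "0 < \<delta>2" "\<And>s. s \<in> {0..t} \<Longrightarrow> well_separated N \<delta>2 (\<lambda>j. y j s)"
    using exists_separation[OF cy iy] by blast
  define \<delta> where "\<delta> = min \<delta>1 \<delta>2"
  have \<delta>: "0 < \<delta>" "well_separated N \<delta> (\<lambda>j. x j s)" "well_separated N \<delta> (\<lambda>j. y j s)" if "s \<in> {0..t}" for s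
    using \<delta>1 \<delta>2(1) \<delta>2(2)[OF that] \<delta>1(2)[OF that] unfolding \<delta>_def well_separated_def by (auto simp: min_le_iff_disj)
  define M where "M = (\<Sum>k=1..N. \<bar>real_of_int (m k)\<bar>)"
  have M: "\<bar>real_of_int (m k)\<bar> \<le> M" if "k \<in> {1..N}" for k
    unfolding M_def using that by (intro member_le_sum) auto
  define f where "f = (\<lambda>s. \<Sum>k=1..N. (norm (x k s - y k s))\<^sup>2)"
  define W where "W = (\<lambda>s k. vortex_velocity N m (\<lambda>k. x k s) k - vortex_velocity N m (\<lambda>k. y k s) k)"
  define L where "L = 4 * M\<^sup>2 * real N / \<delta>\<^sup>2"
  have le_f: "norm (x k s - y k s) \<le> sqrt (f s)" if "k \<in> {1..N}" for k s
  proof (rule real_le_rsqrt)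
    show "(norm (x k s - y k s))\<^sup>2 \<le> f s"
      unfolding f_def using that by (intro member_le_sum[where f = "\<lambda>k. (norm (x k s - y k s))\<^sup>2"]) auto
  qed
  have f0: "0 \<le> f s" for s unfolding f_def by (intro sum_nonneg) auto
  have "f t \<le> 0"
  proof (rule gronwall_zero[OF t(1)])
    show "continuous_on {0..t} f" unfolding f_def by (intro continuous_intros cx cy)
    show "f 0 \<le> 0" unfolding f_def using x y by (auto simp: vortex_solution_def intro!: sum_nonpos)
  next
    fix s assume s: "0 < s" "s < t"
    show "(f has_real_derivative (\<Sum>k=1..N. 2 * ((x k s - y k s) \<bullet> W s k))) (at s)"
      unfolding f_def
    proof (rule DERIV_sum)
      fix k assume k: "k \<in> {1..N}"
      have "((\<lambda>s. x k s - y k s) has_vector_derivative W s k) (at s)"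
        unfolding W_def by (intro has_vector_derivative_diff dx dy k s)
      hence "((\<lambda>s. x k s - y k s) has_derivative (\<lambda>h. h *\<^sub>R W s k)) (at s)"
        by (simp add: has_vector_derivative_def)
      from has_derivative_inner[OF this this]
      show "((\<lambda>s. (norm (x k s - y k s))\<^sup>2) has_real_derivative 2 * ((x k s - y k s) \<bullet> W s k)) (at s)"
        unfolding power2_norm_eq_inner has_field_derivative_def
        by (rule has_derivative_eq_rhs) (auto simp: inner_commute algebra_simps)
    qed
    \<comment> \<open>By Cauchy-Schwarz each of the \<open>N\<close> summands of the derivative is
      at most \<open>2 * L * f s\<close>, which yields the constant
      \<open>2 * N * L\<close>.\<close>
    have "norm (W s k) \<le> L * sqrt (f s)" if k: "k \<in> {1..N}" for k
      unfolding W_def L_def using s by (intro norm_vortex_velocity_diff_le \<delta>[of s] k M le_f) auto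
    hence le: "(x k s - y k s) \<bullet> W s k \<le> sqrt (f s) * (L * sqrt (f s))" if k: "k \<in> {1..N}" for k
      using k le_f[OF k, of s] f0[of s]
      by (intro order_trans[OF norm_cauchy_schwarz] mult_mono) auto
    have "sqrt (f s) * (L * sqrt (f s)) = L * f s" using f0[of s] by simp
    hence "(x k s - y k s) \<bullet> W s k \<le> L * f s" if k: "k \<in> {1..N}" for k
      using le[OF k] by (simp only:)
    hence "(\<Sum>k=1..N. 2 * ((x k s - y k s) \<bullet> W s k)) \<le> (\<Sum>k=1..N. 2 * (L * f s))"
      by (intro sum_mono mult_left_mono) auto
    thus "(\<Sum>k=1..N. 2 * ((x k s - y k s) \<bullet> W s k)) \<le> (2 * real N * L) * f s" by simp
  qed
  hence "f t = 0" using f0[of t] by simp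
  hence "norm (x j t - y j t) \<le> 0" using le_f[OF j, of t] by simp
  thus ?thesis by simp
qed

lemma the_vortex_solution_global:
  assumes "vortex_solution N m x0 \<infinity> x"
  shows "the_vortex_solution N m x0 \<infinity> x"
  unfolding the_vortex_solution_def
proof (intro conjI allI impI ballI)
  fix T' y j t assume "vortex_solution N m x0 T' y" "j \<in> {1..N}" "0 \<le> t \<and> ereal t < T'"
  thus "y j t = x j t" using vortex_solution_unique[OF assms] by simp
qed (use assms in simp_all)

text \<open>A solution alive at \<open>Tc\<close> would agree with \<open>x\<close> before
  \<open>Tc\<close>, hence by continuity also at \<open>Tc\<close> for the indices \<open>j\<close>
  and \<open>k\<close>, and would place these two distinct vortices at the same point.\<close>

lemma the_vortex_solution_collision:
  assumes x: "vortex_solution N m x0 (ereal Tc) x"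
    and cont: "continuous_on {0..Tc} (x j)" "continuous_on {0..Tc} (x k)"
    and jk: "j \<in> {1..N}" "k \<in> {1..N}" "j \<noteq> k" "x j Tc = x k Tc"
  shows "the_vortex_solution N m x0 (ereal Tc) x"
  unfolding the_vortex_solution_def
proof (intro conjI allI impI ballI x)
  fix T' y assume y: "vortex_solution N m x0 T' y"
  have Tc: "0 < Tc" using x by (simp add: vortex_solution_def zero_ereal_def)
  show le: "T' \<le> ereal Tc"
  proof (rule ccontr)
    assume "\<not> T' \<le> ereal Tc"
    hence T': "ereal Tc < T'" by simp
    have sub: "{0..Tc} \<subseteq> {t. 0 \<le> t \<and> ereal t < T'}"
      using T' by (auto intro: le_less_trans[of _ "ereal Tc"])
    have lim: "(f \<longlongrightarrow> f Tc) (at_left Tc)" if "continuous_on {0..Tc} f" for f :: "real \<Rightarrow> real^2"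
      using that Tc by (simp add: continuous_on_Icc_at_leftD)
    have eq: "y i Tc = x i Tc" if i: "i \<in> {1..N}" "continuous_on {0..Tc} (x i)" for i
    proof (rule tendsto_unique)
      show "\<not> trivial_limit (at_left Tc)" by simp
      have "continuous_on {0..Tc} (y i)"
        using y i sub unfolding vortex_solution_def by (blast intro: continuous_on_subset)
      thus "(y i \<longlongrightarrow> y i Tc) (at_left Tc)" by (rule lim)
      have "\<forall>\<^sub>F t in at_left Tc. x i t = y i t"
        using eventually_at_left_real[OF Tc]
      proof eventually_elim
        case (elim t)
        hence "ereal t < ereal Tc" "0 \<le> t" by auto
        moreover from this have "ereal t < T'" using T' by (meson less_trans)
        ultimately show ?case using vortex_solution_unique[OF x y _ _ _ i(1)] by simp
      qed
      with lim[OF i(2)] show "(y i \<longlongrightarrow> x i Tc) (at_left Tc)" by (rule Lim_transform_eventually)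
    qed
    have "inj_on (\<lambda>j. y j Tc) {1..N}" using y T' Tc by (simp add: vortex_solution_def)
    moreover have "y j Tc = y k Tc" using eq jk cont by simp
    ultimately show False using jk by (auto dest: inj_onD)
  qed
  fix j t assume "j \<in> {1..N}" "0 \<le> t \<and> ereal t < T'"
  thus "y j t = x j t" using vortex_solution_unique[OF x y] le by (meson less_le_trans)
qed

section \<open>Scalar autonomous equations\<close>

text \<open>Separation of variables: \<open>H x\<close> is the time needed to descend from
  \<open>b\<close> to \<open>x\<close>, and \<open>y\<close> is the inverse of \<open>H\<close>. The
  linear bound on \<open>g\<close> makes this time tend to infinity at \<open>a\<close>, so the
  solution exists for all positive times and never reaches \<open>a\<close>.\<close>

lemma ode_decreasing_to_equilibrium:
  fixes g :: "real \<Rightarrow> real"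
  assumes ab: "a < b" and bc: "b < c"
    and cont: "\<And>x. a < x \<Longrightarrow> x < c \<Longrightarrow> isCont g x"
    and pos: "\<And>x. a < x \<Longrightarrow> x < c \<Longrightarrow> 0 < g x"
    and bound: "\<And>x. a < x \<Longrightarrow> x \<le> b \<Longrightarrow> g x \<le> C * (x - a)"
  shows "\<exists>y. y 0 = b \<and> (\<forall>t\<ge>0. a < y t \<and> y t \<le> b \<and> (y has_real_derivative - g (y t)) (at t)) \<and>
           (y \<longlongrightarrow> a) at_top"
proof -
  have "0 < C * (b - a)" using pos[of b] bound[of b] ab bc by simp
  hence C: "0 < C" using ab by (simp add: zero_less_mult_iff)
  have "ereal a < ereal c" using ab bc by simp
  from einterval_antiderivative[OF this, of "\<lambda>x. - inverse (g x)"]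
  obtain H0 where H0: "\<And>x. a < x \<Longrightarrow> x < c \<Longrightarrow> (H0 has_vector_derivative - inverse (g x)) (at x)"
    using cont pos by (force intro!: continuous_intros)
  define H where "H = (\<lambda>x. H0 x - H0 b)"
  have dH: "(H has_real_derivative - inverse (g x)) (at x)" if "a < x" "x < c" for x
    unfolding H_def using H0[OF that]
    by (auto intro!: derivative_eq_intros simp: has_real_derivative_iff_has_vector_derivative)
  have Hb: "H b = 0" by (simp add: H_def)
  have contH: "isCont H x" if "a < x" "x < c" for x
    using dH[OF that] by (rule DERIV_isCont)
  have dec: "H z < H x" if "a < x" "x < z" "z < c" for x z
  proof (rule DERIV_neg_imp_decreasing[OF that(2)])
    fix w assume "x \<le> w" "w \<le> z"
    thus "\<exists>y. (H has_real_derivative y) (at w) \<and> y < 0"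
      using dH[of w] pos[of w] that by (intro exI[of _ "- inverse (g w)"]) auto
  qed
  have inj: "x = z" if "a < x" "x < c" "a < z" "z < c" "H x = H z" for x z
    using dec[of x z] dec[of z x] that by (cases x z rule: linorder_cases) auto
  \<comment> \<open>Comparison with \<open>x' = - C * (x - a)\<close>, whose descent time from
    \<open>b\<close> to \<open>x\<close> is the left-hand side.\<close>
  have lower: "ln ((b - a) / (x - a)) / C \<le> H x" if x: "a < x" "x \<le> b" for x
  proof -
    let ?h = "\<lambda>x. H x + ln (x - a) / C"
    have "?h b \<le> ?h x"
    proof (rule DERIV_nonpos_imp_nonincreasing[OF x(2)])
      fix w assume w: "x \<le> w" "w \<le> b"
      hence w': "a < w" "w < c" using x bc by auto
      have "(?h has_real_derivative - inverse (g w) + inverse (w - a) / C) (at w)"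
        using dH[OF w'] w' C by (auto intro!: derivative_eq_intros simp: field_simps)
      moreover have "- inverse (g w) + inverse (w - a) / C \<le> 0"
      proof -
        have "inverse (C * (w - a)) \<le> inverse (g w)"
          using bound[of w] pos[OF w'] w w' by (intro le_imp_inverse_le) auto
        thus ?thesis using C w' by (simp add: field_simps)
      qed
      ultimately show "\<exists>y. (?h has_real_derivative y) (at w) \<and> y \<le> 0" by blast
    qed
    thus ?thesis using x ab C by (simp add: Hb ln_div field_simps)
  qed
  have surj: "\<exists>x. a < x \<and> x \<le> b \<and> H x = t" if t: "0 \<le> t" for t
  proof -
    \<comment> \<open>The position at time \<open>t\<close> of the comparison solution; the lower
      bound for \<open>H\<close> at this point equals \<open>t\<close>.\<close>
    define x0 where "x0 = a + (b - a) * exp (- C * t)"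
    have e: "exp (- C * t) \<le> 1" using C t by simp
    have x0: "a < x0" "x0 \<le> b"
    proof -
      show "a < x0" using ab by (simp add: x0_def)
      have "(b - a) * exp (- C * t) \<le> (b - a) * 1" using ab e by (intro mult_left_mono) auto
      thus "x0 \<le> b" by (simp add: x0_def)
    qed
    have "t \<le> H x0"
    proof -
      have "(b - a) / (x0 - a) = exp (C * t)" using ab by (simp add: x0_def exp_minus divide_inverse)
      thus ?thesis using lower[OF x0] C by simp
    qed
    moreover have "\<forall>x. x0 \<le> x \<and> x \<le> b \<longrightarrow> isCont H x" using contH x0 bc by auto
    ultimately obtain x where "x0 \<le> x" "x \<le> b" "H x = t"
      using IVT2[of H b t x0] Hb t x0(2) by auto
    thus ?thesis using x0 by (intro exI[of _ x]) auto
  qed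
  \<comment> \<open>Inverting on all of \<open>{a<..<c}\<close>, beyond the starting point
    \<open>b\<close>, also covers small negative times, which the two-sided derivative at
    \<open>t = 0\<close> needs.\<close>
  define y where "y = (\<lambda>t. THE x. a < x \<and> x < c \<and> H x = t)"
  have yH: "y (H x) = x" if "a < x" "x < c" for x
    unfolding y_def by (rule the_equality) (use that inj in auto)
  have y: "a < y t \<and> y t \<le> b \<and> H (y t) = t" if "0 \<le> t" for t
  proof -
    obtain x where "a < x" "x \<le> b" "H x = t" using surj[OF \<open>0 \<le> t\<close>] by blast
    moreover from this have "y t = x" using yH[of x] bc by auto
    ultimately show ?thesis by simp
  qed
  have dy: "(y has_real_derivative - g (y t)) (at t)" if t: "0 \<le> t" for t
  proof -
    have yt: "a < y t" "y t < c" "H (y t) = t" using y[OF t] bc by auto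
    have "(y has_derivative (\<lambda>h. - g (y t) * h)) (at (H (y t)))"
    proof (rule has_derivative_inverse_strong[of "{a<..<c}" _ H])
      show "(H has_derivative (\<lambda>h. - inverse (g (y t)) * h)) (at (y t))"
        using dH[OF yt(1,2)] unfolding has_field_derivative_def .
      show "continuous_on {a<..<c} H"
        using contH by (intro continuous_at_imp_continuous_on) auto
    qed (use yt yH pos[OF yt(1,2)] in \<open>auto simp: fun_eq_iff\<close>)
    thus ?thesis unfolding yt(3) has_field_derivative_def .
  qed
  have lim: "(y \<longlongrightarrow> a) at_top"
  proof (rule decreasing_tendsto)
    show "\<forall>\<^sub>F t in at_top. a \<le> y t"
      using eventually_ge_at_top[of 0] by eventually_elim (use y in fastforce)
    fix z assume "a < z"
    define w where "w = min ((a + z) / 2) b"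
    have w: "a < w" "w < z" "w \<le> b" using \<open>a < z\<close> ab by (auto simp: w_def min_def field_simps)
    show "\<forall>\<^sub>F t in at_top. y t < z"
      using eventually_ge_at_top[of "max 0 (H w)"]
    proof eventually_elim
      case (elim t)
      hence yt: "a < y t" "y t \<le> b" "H (y t) = t" using y[of t] by auto
      show ?case
      proof (rule ccontr)
        assume "\<not> y t < z"
        hence "H (y t) < H w" using w yt bc by (intro dec) auto
        thus False using yt elim by simp
      qed
    qed
  qed
  show ?thesis
    using y dy lim yH[of b] ab bc Hb by (intro exI[of _ y]) auto
qed

text \<open>Above \<open>e\<close> the previous lemma applies to \<open>- g\<close>, below
  \<open>e\<close> to the reflected equation, and at \<open>e\<close> the solution is constant. The
  equilibrium may be an endpoint of the interval, as happens for \<open>n = 3\<close>.\<close>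

lemma ode_to_stable_equilibrium:
  fixes g :: "real \<Rightarrow> real"
  assumes q0: "l < q0" "q0 < u" and e: "l \<le> e" "e \<le> u"
    and cont: "\<And>x. l < x \<Longrightarrow> x < u \<Longrightarrow> isCont g x"
    and pos: "\<And>x. l < x \<Longrightarrow> x < e \<Longrightarrow> 0 < g x"
    and neg: "\<And>x. e < x \<Longrightarrow> x < u \<Longrightarrow> g x < 0"
    and bound: "\<And>x. x \<in> closed_segment e q0 \<Longrightarrow> \<bar>g x\<bar> \<le> C * \<bar>x - e\<bar>"
  shows "\<exists>y. y 0 = q0 \<and> (\<forall>t\<ge>0. l < y t \<and> y t < u \<and> (y has_real_derivative g (y t)) (at t)) \<and>
           (y \<longlongrightarrow> e) at_top"
proof (cases q0 e rule: linorder_cases)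
  case equal
  have "g q0 = 0" using bound[of e] equal by simp
  thus ?thesis using equal q0 by (intro exI[of _ "\<lambda>_. q0"]) auto
next
  case greater
  have "\<exists>y. y 0 = q0 \<and> (\<forall>t\<ge>0. e < y t \<and> y t \<le> q0 \<and> (y has_real_derivative - (- g (y t))) (at t)) \<and>
      (y \<longlongrightarrow> e) at_top"
  proof (rule ode_decreasing_to_equilibrium)
    fix x assume "e < x" "x \<le> q0"
    thus "- g x \<le> C * (x - e)" using bound[of x] greater by (simp add: closed_segment_eq_real_ivl)
  next
    fix x assume "e < x" "x < u"
    thus "isCont (\<lambda>x. - g x) x" "0 < - g x" using cont neg[of x] e by auto
  qed (use greater q0 in auto)
  then obtain y where y: "y 0 = q0"
    "\<forall>t\<ge>0. e < y t \<and> y t \<le> q0 \<and> (y has_real_derivative - (- g (y t))) (at t)" "(y \<longlongrightarrow> e) at_top"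
    by blast
  have "l < y t \<and> y t < u \<and> (y has_real_derivative g (y t)) (at t)" if "0 \<le> t" for t
    using y(2)[rule_format, OF that] q0 e by simp
  thus ?thesis using y(1,3) by blast
next
  case less
  have "\<exists>y. y 0 = - q0 \<and> (\<forall>t\<ge>0. - e < y t \<and> y t \<le> - q0 \<and> (y has_real_derivative - g (- y t)) (at t)) \<and>
      (y \<longlongrightarrow> - e) at_top"
  proof (rule ode_decreasing_to_equilibrium)
    fix x assume "- e < x" "x \<le> - q0"
    thus "g (- x) \<le> C * (x - - e)" using bound[of "- x"] less by (simp add: closed_segment_eq_real_ivl add.commute)
  next
    fix x assume x: "- e < x" "x < - l"
    show "isCont (\<lambda>x. g (- x)) x"
      by (rule isCont_o2[where g = g]) (use cont[of "- x"] x e in auto)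
    show "0 < g (- x)" using pos[of "- x"] x by simp
  qed (use less q0 in auto)
  then obtain y where y: "y 0 = - q0"
    "\<forall>t\<ge>0. - e < y t \<and> y t \<le> - q0 \<and> (y has_real_derivative - g (- y t)) (at t)" "(y \<longlongrightarrow> - e) at_top"
    by blast
  have "l < - y t \<and> - y t < u \<and> ((\<lambda>t. - y t) has_real_derivative g (- y t)) (at t)" if "0 \<le> t" for t
  proof -
    have *: "- e < y t" "y t \<le> - q0" "(y has_real_derivative - g (- y t)) (at t)"
      using y(2) that by auto
    show ?thesis using DERIV_minus[OF *(3)] *(1,2) q0 e by simp
  qed
  moreover have "((\<lambda>t. - y t) \<longlongrightarrow> e) at_top" using tendsto_minus[OF y(3)] by simp
  ultimately show ?thesis using y(1) by (intro exI[of _ "\<lambda>t. - y t"]) simp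
qed

section \<open>Evolution of the radii\<close>

text \<open>Induction through \<open>s^(n+1) - t^(n+1) = s (s^n - t^n) + t^n (s - t)\<close>, where
  \<open>s \<le> 1\<close> and \<open>t^n \<le> s + t\<close>.\<close>

lemma power_diff_le_square_diff:
  fixes s t :: real
  assumes "2 \<le> n" "0 \<le> t" "t \<le> s" "s \<le> 1"
  shows "s ^ n - t ^ n \<le> real n * (s\<^sup>2 - t\<^sup>2)"
  using assms(1)
proof (induction n rule: dec_induct)
  case base
  have "0 \<le> s\<^sup>2 - t\<^sup>2" using assms by (simp add: power_mono)
  thus ?case by simp
next
  case (step n)
  have "s * (s ^ n - t ^ n) \<le> 1 * (s ^ n - t ^ n)"
    using assms by (intro mult_right_mono) (auto intro: power_mono)
  moreover have "t ^ n * (s - t) \<le> (s + t) * (s - t)"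
  proof (rule mult_right_mono)
    have "t ^ n \<le> t ^ 1" using step assms by (intro power_decreasing) auto
    thus "t ^ n \<le> s + t" using assms by simp
  qed (use assms in auto)
  ultimately show ?case using step.IH by (simp add: power2_eq_square algebra_simps)
qed

text \<open>The square root alone is not Lipschitz at 0, but its \<open>n\<close>-th power is, as
  \<open>2 \<le> n\<close>. The endpoint 0 matters because it is the equilibrium when
  \<open>n = 3\<close>.\<close>

lemma sqrt_power_lipschitz:
  fixes x y :: real
  assumes "2 \<le> n" "x \<in> {0..1}" "y \<in> {0..1}"
  shows "\<bar>sqrt x ^ n - sqrt y ^ n\<bar> \<le> real n * \<bar>x - y\<bar>"
proof -
  have le: "\<bar>sqrt x ^ n - sqrt y ^ n\<bar> \<le> real n * \<bar>x - y\<bar>" if "x \<le> y" "x \<in> {0..1}" "y \<in> {0..1}" for x y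
  proof -
    have "sqrt x ^ n \<le> sqrt y ^ n" using that by (intro power_mono) auto
    moreover have "sqrt y ^ n - sqrt x ^ n \<le> real n * ((sqrt y)\<^sup>2 - (sqrt x)\<^sup>2)"
      using that assms(1) by (intro power_diff_le_square_diff) auto
    ultimately show ?thesis using that by simp
  qed
  show ?thesis
    using le[of x y] le[of y x] assms by (cases "x \<le> y") (auto simp: abs_minus_commute)
qed

text \<open>
  Up to the positive factor \<open>(1 + q) / ((8 n - 12) (1 - sqrt q ^ n))\<close>, this is the derivative of the ratio
  \<open>q\<close> of the two squared radii with respect to the logarithm of their sum.
\<close>

definition ratio_drift :: "nat \<Rightarrow> real \<Rightarrow> real" where
  "ratio_drift n q = 2 * (real n - 3) * ((1 - q) * (1 - sqrt q ^ n)) - 4 * real n * (sqrt q ^ n + q)"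

text \<open>With \<open>p = sqrt x ^ n\<close>, both \<open>(1 - x) * (1 - p)\<close> and
  \<open>p + x\<close> have Lipschitz constant \<open>1 + n\<close>; the coefficients in front are
  at most \<open>2 * n\<close> and \<open>4 * n\<close>.\<close>

lemma ratio_drift_lipschitz:
  assumes n: "3 \<le> n" and xy: "x \<in> {0..1}" "y \<in> {0..1}"
  shows "\<bar>ratio_drift n x - ratio_drift n y\<bar> \<le> 6 * real n * (1 + real n) * \<bar>x - y\<bar>"
proof -
  let ?p = "\<lambda>x. sqrt x ^ n" and ?A = "2 * (real n - 3)"
  have p: "\<bar>?p x - ?p y\<bar> \<le> real n * \<bar>x - y\<bar>" using n xy by (intro sqrt_power_lipschitz) auto
  have p01: "0 \<le> ?p y" "?p y \<le> 1" using xy by (auto intro: power_le_one)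
  have "(1 - x) * (1 - ?p x) - (1 - y) * (1 - ?p y) = - ((1 - x) * (?p x - ?p y)) - (x - y) * (1 - ?p y)"
    by (simp add: algebra_simps)
  hence "\<bar>(1 - x) * (1 - ?p x) - (1 - y) * (1 - ?p y)\<bar> \<le> \<bar>(1 - x) * (?p x - ?p y)\<bar> + \<bar>(x - y) * (1 - ?p y)\<bar>"
    by linarith
  also have "\<dots> \<le> 1 * \<bar>?p x - ?p y\<bar> + \<bar>x - y\<bar> * 1"
    unfolding abs_mult using xy p01 by (intro add_mono mult_mono) auto
  also have "\<dots> \<le> (1 + real n) * \<bar>x - y\<bar>" using p by (simp add: algebra_simps)
  finally have 1: "\<bar>(1 - x) * (1 - ?p x) - (1 - y) * (1 - ?p y)\<bar> \<le> (1 + real n) * \<bar>x - y\<bar>" .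
  have 2: "\<bar>(?p x + x) - (?p y + y)\<bar> \<le> (1 + real n) * \<bar>x - y\<bar>" using p by (simp add: algebra_simps)
  have "ratio_drift n x - ratio_drift n y =
      ?A * ((1 - x) * (1 - ?p x) - (1 - y) * (1 - ?p y)) - 4 * real n * ((?p x + x) - (?p y + y))"
    unfolding ratio_drift_def by (simp add: algebra_simps)
  hence "\<bar>ratio_drift n x - ratio_drift n y\<bar> \<le>
      \<bar>?A * ((1 - x) * (1 - ?p x) - (1 - y) * (1 - ?p y))\<bar> + \<bar>4 * real n * ((?p x + x) - (?p y + y))\<bar>"
    by linarith
  also have "\<dots> \<le> (2 * real n) * ((1 + real n) * \<bar>x - y\<bar>) + 4 * real n * ((1 + real n) * \<bar>x - y\<bar>)"
    unfolding abs_mult[of ?A] abs_mult[of "4 * real n"] using 1 2 n by (intro add_mono mult_mono) auto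
  finally show ?thesis by (simp add: algebra_simps)
qed

text \<open>The first product is nonincreasing and its coefficient vanishes for
  \<open>n = 3\<close>; strictness comes from \<open>sqrt q ^ n + q\<close>.\<close>

lemma ratio_drift_strict_antimono:
  assumes n: "3 \<le> n" and xy: "0 \<le> x" "x < y" "y \<le> 1"
  shows "ratio_drift n y < ratio_drift n x"
proof -
  have p: "sqrt x ^ n < sqrt y ^ n" "sqrt y ^ n \<le> 1"
    using n xy by (auto intro!: power_strict_mono power_le_one)
  have "(1 - y) * (1 - sqrt y ^ n) \<le> (1 - x) * (1 - sqrt x ^ n)"
    using xy p by (intro mult_mono) auto
  hence "2 * (real n - 3) * ((1 - y) * (1 - sqrt y ^ n)) \<le> 2 * (real n - 3) * ((1 - x) * (1 - sqrt x ^ n))"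
    using n by (intro mult_left_mono) auto
  moreover have "4 * real n * (sqrt x ^ n + x) < 4 * real n * (sqrt y ^ n + y)"
    using n p xy by (intro mult_strict_left_mono) auto
  ultimately show ?thesis unfolding ratio_drift_def by linarith
qed

section \<open>Equilibrium of the ratio of the squared radii\<close>

lemma ratio_drift_zero_exists:
  assumes "3 \<le> n"
  shows "\<exists>q. 0 \<le> q \<and> q < 1 \<and> ratio_drift n q = 0"
proof -
  have "\<exists>q\<ge>0. q \<le> 1 \<and> ratio_drift n q = 0"
  \<comment> \<open>The drift equals \<open>2 * (n - 3)\<close> at 0 and \<open>- 8 * n\<close> at
    1.\<close>
  proof (rule IVT2')
    show "continuous_on {0..1} (ratio_drift n)"
      unfolding ratio_drift_def by (intro continuous_intros)
  qed (use assms in \<open>auto simp: ratio_drift_def power_0_left\<close>)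
  then obtain q where q: "0 \<le> q" "q \<le> 1" "ratio_drift n q = 0" by blast
  moreover have "q \<noteq> 1" using q assms by (auto simp: ratio_drift_def)
  ultimately show ?thesis by (intro exI[of _ q]) auto
qed

text \<open>For \<open>3 \<le> n\<close> the choice is unique, since the drift is strictly
  decreasing. The value turns out to be the limit of \<open>\<rho>1 / \<rho>2\<close>.\<close>

definition limit_ratio :: "nat \<Rightarrow> real" where
  "limit_ratio n = (SOME q. 0 \<le> q \<and> q < 1 \<and> ratio_drift n q = 0)"

lemma limit_ratio:
  assumes "3 \<le> n"
  shows limit_ratio_nonneg: "0 \<le> limit_ratio n"
    and limit_ratio_less_one: "limit_ratio n < 1"
    and ratio_drift_limit_ratio: "ratio_drift n (limit_ratio n) = 0"
  using someI_ex[OF ratio_drift_zero_exists[OF assms]] unfolding limit_ratio_def by blast+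

text \<open>For \<open>n = 3\<close> the drift reduces to \<open>- 12 * (sqrt q ^ 3 + q)\<close>, a
  multiple of a sum of nonnegative terms.\<close>

lemma limit_ratio_3: "limit_ratio 3 = 0"
proof -
  have "0 \<le> limit_ratio 3" "sqrt (limit_ratio 3) ^ 3 + limit_ratio 3 = 0"
    using limit_ratio[of 3] by (auto simp: ratio_drift_def)
  moreover from this have "0 \<le> sqrt (limit_ratio 3) ^ 3" by simp
  ultimately show ?thesis by linarith
qed

lemma limit_ratio_pos:
  assumes "4 \<le> n"
  shows "0 < limit_ratio n"
proof -
  have "ratio_drift n 0 \<noteq> 0" using assms by (simp add: ratio_drift_def power_0_left)
  hence "limit_ratio n \<noteq> 0" using ratio_drift_limit_ratio[of n] assms by auto
  thus ?thesis using limit_ratio_nonneg[of n] assms by simp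
qed

text \<open>The drift points toward \<open>limit_ratio n\<close> from both sides, and the factor
  \<open>(1 + y) / (1 - sqrt y ^ n)\<close> is positive. The Lipschitz bound on the drift supplies
  the linear bound near the equilibrium.\<close>

lemma ratio_ode:
  assumes n: "3 \<le> n" and q0: "0 < q0" "q0 < 1"
  shows "\<exists>y. y 0 = q0 \<and> (\<forall>t\<ge>0. 0 < y t \<and> y t < 1 \<and>
             (y has_real_derivative (1 + y t) * ratio_drift n (y t) / (1 - sqrt (y t) ^ n)) (at t)) \<and>
           (y \<longlongrightarrow> limit_ratio n) at_top"
proof -
  let ?e = "limit_ratio n"
  \<comment> \<open>All points between the equilibrium and the starting value are at most
    \<open>M < 1\<close>, which keeps the denominator \<open>1 - sqrt x ^ n\<close> away from
    0.\<close>
  define M where "M = max ?e q0"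
  have p1: "sqrt x ^ n < 1" if "0 \<le> x" "x < 1" for x
    using power_strict_mono[of "sqrt x" 1 n] that n by simp
  have M: "0 \<le> M" "M < 1" using limit_ratio[OF n] q0 by (auto simp: M_def)
  note e = limit_ratio[OF n]
  have d: "0 < 1 - sqrt M ^ n" using p1[OF M] by simp
  show ?thesis
  proof (rule ode_to_stable_equilibrium)
    fix x :: real assume x: "0 < x" "x < 1"
    show "isCont (\<lambda>x. (1 + x) * ratio_drift n x / (1 - sqrt x ^ n)) x"
      using p1[of x] x unfolding ratio_drift_def by (intro continuous_intros) auto
  next
    fix x assume x: "0 < x" "x < ?e"
    hence "0 < ratio_drift n x" using ratio_drift_strict_antimono[OF n, of x ?e] e by simp
    thus "0 < (1 + x) * ratio_drift n x / (1 - sqrt x ^ n)" using p1[of x] x e by simp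
  next
    fix x assume x: "?e < x" "x < 1"
    hence "ratio_drift n x < 0" using ratio_drift_strict_antimono[OF n, of ?e x] e by simp
    thus "(1 + x) * ratio_drift n x / (1 - sqrt x ^ n) < 0"
      using p1[of x] x e by (intro divide_neg_pos mult_pos_neg) auto
  next
    fix x assume "x \<in> closed_segment ?e q0"
    hence x: "0 \<le> x" "x \<le> M" "x < 1" using e q0 by (auto simp: closed_segment_eq_real_ivl M_def split: if_splits)
    have "\<bar>ratio_drift n x\<bar> \<le> 6 * real n * (1 + real n) * \<bar>x - ?e\<bar>"
      using ratio_drift_lipschitz[OF n, of x ?e] x e by simp
    moreover have "sqrt x ^ n \<le> sqrt M ^ n" using x by (intro power_mono) auto
    ultimately have "(1 + x) * \<bar>ratio_drift n x\<bar> / (1 - sqrt x ^ n) \<le>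
        2 * (6 * real n * (1 + real n) * \<bar>x - ?e\<bar>) / (1 - sqrt M ^ n)"
      using x d by (intro frac_le mult_mono) auto
    thus "\<bar>(1 + x) * ratio_drift n x / (1 - sqrt x ^ n)\<bar> \<le>
        (2 * (6 * real n * (1 + real n)) / (1 - sqrt M ^ n)) * \<bar>x - ?e\<bar>"
      using x p1[of x] by (simp add: abs_mult mult.assoc)
  qed (use q0 e in auto)
qed

text \<open>Adding the radial equations shows that the sum \<open>S\<close> has slope
  \<open>8 * n - 12\<close>, and the ratio \<open>q\<close> satisfies
  \<open>S * q' = (1 + q) * ratio_drift n q / (1 - sqrt q ^ n)\<close>. The proof constructs
  \<open>S\<close> and \<open>q\<close> first, recovers the squared radii from them and then
  verifies both equations.\<close>

lemma two_ring_radii: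
  assumes n: "3 \<le> n" and R: "0 < R1" "R1 < R2"
  shows "\<exists>\<rho>1 \<rho>2. \<rho>1 0 = R1 \<and> \<rho>2 0 = R2 \<and>
    (\<forall>t\<ge>0. 0 < \<rho>1 t \<and> \<rho>1 t < \<rho>2 t \<and>
      \<rho>1 t + \<rho>2 t = R1 + R2 + (8 * real n - 12) * t \<and>
      (\<rho>1 has_real_derivative 2 * (real n - 3) - 4 * real n * sqrt (\<rho>1 t) ^ n / (sqrt (\<rho>2 t) ^ n - sqrt (\<rho>1 t) ^ n)) (at t) \<and>
      (\<rho>2 has_real_derivative 2 * (real n - 3) + 4 * real n * sqrt (\<rho>2 t) ^ n / (sqrt (\<rho>2 t) ^ n - sqrt (\<rho>1 t) ^ n)) (at t)) \<and>
    ((\<lambda>t. \<rho>1 t / \<rho>2 t) \<longlongrightarrow> limit_ratio n) at_top"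
proof -
  define c where "c = 8 * real n - 12"
  have c: "0 < c" using n by (simp add: c_def)
  obtain y where y: "y 0 = R1 / R2" "\<forall>t\<ge>0. 0 < y t \<and> y t < 1 \<and>
             (y has_real_derivative (1 + y t) * ratio_drift n (y t) / (1 - sqrt (y t) ^ n)) (at t)"
    "(y \<longlongrightarrow> limit_ratio n) at_top"
    using ratio_ode[OF n, of "R1 / R2"] R by auto
  define S where "S = (\<lambda>t. R1 + R2 + c * t)"
  \<comment> \<open>The new time starts at 0 and satisfies \<open>\<tau>' = 1 / S\<close>, which
    absorbs the factor \<open>S\<close>.\<close>
  define \<tau> where "\<tau> = (\<lambda>t. ln (S t / (R1 + R2)) / c)"
  define q where "q = (\<lambda>t. y (\<tau> t))"
  define \<rho>1 where "\<rho>1 = (\<lambda>t. q t * S t / (1 + q t))"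
  define \<rho>2 where "\<rho>2 = (\<lambda>t. S t / (1 + q t))"
  have S: "R1 + R2 \<le> S t" "0 < S t" if "0 \<le> t" for t
    using that c R mult_nonneg_nonneg[of c t] by (auto simp: S_def add_pos_nonneg)
  have \<tau>: "0 \<le> \<tau> t" if "0 \<le> t" for t
    unfolding \<tau>_def using S[OF that] R c by (intro divide_nonneg_pos ln_ge_zero) auto
  have q: "0 < q t" "q t < 1" if "0 \<le> t" for t
    unfolding q_def using y(2) \<tau>[OF that] by auto
  have dq: "(q has_real_derivative (1 + q t) * ratio_drift n (q t) / (1 - sqrt (q t) ^ n) / S t) (at t)"
    if t: "0 \<le> t" for t
  proof -
    have "(\<tau> has_real_derivative inverse (S t)) (at t)"
      unfolding \<tau>_def using S[OF t] R c
      by (auto simp: S_def intro!: derivative_eq_intros) (simp add: field_simps)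
    from DERIV_chain2[of y, OF conjunct2[OF conjunct2[OF y(2)[rule_format, OF \<tau>[OF t]]]] this]
    show ?thesis unfolding q_def by (simp add: divide_inverse)
  qed
  have sum: "\<rho>1 t + \<rho>2 t = S t" if "1 + q t \<noteq> 0" for t
  proof -
    have "\<rho>1 t + \<rho>2 t = (1 + q t) * S t / (1 + q t)"
      by (simp add: \<rho>1_def \<rho>2_def add_divide_distrib distrib_right)
    thus ?thesis using that by simp
  qed
  have ratio: "\<rho>1 t / \<rho>2 t = q t" if "0 \<le> t" for t
    using q[OF that] S[OF that] by (simp add: \<rho>1_def \<rho>2_def)
  have pos: "0 < \<rho>1 t" "\<rho>1 t < \<rho>2 t" if "0 \<le> t" for t
    using q[OF that] S[OF that] by (auto simp: \<rho>1_def \<rho>2_def divide_strict_right_mono)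
  have deriv: "(\<rho>1 has_real_derivative 2 * (real n - 3) - 4 * real n * sqrt (\<rho>1 t) ^ n / (sqrt (\<rho>2 t) ^ n - sqrt (\<rho>1 t) ^ n)) (at t) \<and>
      (\<rho>2 has_real_derivative 2 * (real n - 3) + 4 * real n * sqrt (\<rho>2 t) ^ n / (sqrt (\<rho>2 t) ^ n - sqrt (\<rho>1 t) ^ n)) (at t)"
    if t: "0 \<le> t" for t
  proof -
    define p where "p = sqrt (q t) ^ n"
    have p: "p < 1" unfolding p_def using power_strict_mono[of "sqrt (q t)" 1 n] q[OF t] n by simp
    note q' = q[OF t] and S' = S(2)[OF t] and pos' = pos[OF t]
    have s1: "sqrt (\<rho>1 t) ^ n = p * sqrt (\<rho>2 t) ^ n"
    proof -
      have "\<rho>1 t = q t * \<rho>2 t" by (simp add: \<rho>1_def \<rho>2_def)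
      thus ?thesis by (simp add: p_def real_sqrt_mult power_mult_distrib)
    qed
    have s2: "0 < sqrt (\<rho>2 t) ^ n" using pos' by simp
    have cancel: "a * x / (x - p * x) = a / (1 - p)" if "0 < x" for a x :: real
    proof -
      have "x - p * x = (1 - p) * x" by (simp add: algebra_simps)
      thus ?thesis using that by simp
    qed
    have e1: "sqrt (\<rho>1 t) ^ n / (sqrt (\<rho>2 t) ^ n - sqrt (\<rho>1 t) ^ n) = p / (1 - p)"
      unfolding s1 by (rule cancel[OF s2])
    have e2: "sqrt (\<rho>2 t) ^ n / (sqrt (\<rho>2 t) ^ n - sqrt (\<rho>1 t) ^ n) = 1 / (1 - p)"
      unfolding s1 using cancel[OF s2, of 1] by simp
    have dS: "(S has_real_derivative c) (at t)"
      unfolding S_def by (auto intro!: derivative_eq_intros)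
    have "(\<rho>2 has_real_derivative (c * (1 + q t) - S t * ((1 + q t) * ratio_drift n (q t) / (1 - p) / S t)) / ((1 + q t) * (1 + q t))) (at t)"
      unfolding \<rho>2_def p_def using q' by (auto intro!: derivative_eq_intros dS dq[OF t])
    moreover have "(c * (1 + q t) - S t * ((1 + q t) * ratio_drift n (q t) / (1 - p) / S t)) / ((1 + q t) * (1 + q t)) =
      2 * (real n - 3) + 4 * real n * (1 / (1 - p))"
    proof -
      have "(c * (1 + q t) - S t * ((1 + q t) * ratio_drift n (q t) / (1 - p) / S t)) / ((1 + q t) * (1 + q t)) =
        (c - ratio_drift n (q t) / (1 - p)) / (1 + q t)"
        using S' q' p by (simp add: divide_simps) (simp add: algebra_simps)
      also have "\<dots> = 2 * (real n - 3) + 4 * real n * (1 / (1 - p))"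
        unfolding ratio_drift_def p_def[symmetric] c_def using q' p
        by (simp add: divide_simps) (simp add: algebra_simps)
      finally show ?thesis .
    qed
    ultimately have d2: "(\<rho>2 has_real_derivative 2 * (real n - 3) + 4 * real n * (1 / (1 - p))) (at t)" by simp
    have "((\<lambda>t. S t - \<rho>2 t) has_real_derivative c - (2 * (real n - 3) + 4 * real n * (1 / (1 - p)))) (at t)"
      by (intro DERIV_diff dS d2)
    \<comment> \<open>The identity is needed on a full neighborhood of \<open>t\<close>, which for
      \<open>t = 0\<close> includes negative times; there the positivity of \<open>q\<close> follows
      from continuity.\<close>
    moreover have "\<forall>\<^sub>F u in nhds t. S u - \<rho>2 u = \<rho>1 u"
    proof -
      have "isCont q t" using dq[OF t] by (rule DERIV_isCont)
      hence "\<forall>\<^sub>F u in nhds t. 0 < q u"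
        using q'(1) by (intro order_tendstoD(1)[of q "q t"]) (auto simp: isCont_def tendsto_at_iff_tendsto_nhds)
      thus ?thesis
      proof eventually_elim
        case (elim u)
        hence "1 + q u \<noteq> 0" by linarith
        thus ?case using sum[of u] by linarith
      qed
    qed
    ultimately have "(\<rho>1 has_real_derivative c - (2 * (real n - 3) + 4 * real n * (1 / (1 - p)))) (at t)"
      by (subst (asm) DERIV_cong_ev[OF refl _ refl]) auto
    moreover have "c - (2 * (real n - 3) + 4 * real n * (1 / (1 - p))) = 2 * (real n - 3) - 4 * real n * (p / (1 - p))"
      unfolding c_def using p by (simp add: field_simps)
    ultimately have d1: "(\<rho>1 has_real_derivative 2 * (real n - 3) - 4 * real n * (p / (1 - p))) (at t)" by (simp only:)
    show ?thesis
      unfolding times_divide_eq_right[symmetric] e1 e2 using d1 d2 by blast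
  qed
  have init: "\<rho>1 0 = R1" "\<rho>2 0 = R2"
  proof -
    have q0: "q 0 = R1 / R2" and S0: "S 0 = R1 + R2"
      using y(1) R by (auto simp: q_def \<tau>_def S_def)
    have "1 + R1 / R2 = (R1 + R2) / R2" using R by (simp add: field_simps)
    thus "\<rho>2 0 = R2" using R unfolding \<rho>2_def q0 S0 by simp
    thus "\<rho>1 0 = R1" using sum[of 0] q[of 0] S0 by simp
  qed
  \<comment> \<open>The logarithmic time runs to infinity, so \<open>q\<close> inherits the limit of
    \<open>y\<close>.\<close>
  have "filterlim \<tau> at_top at_top"
  proof -
    have "filterlim (\<lambda>t. S t / (R1 + R2)) at_top at_top"
    proof -
      have "S t / (R1 + R2) = 1 + c / (R1 + R2) * t" for t
        using R by (simp add: S_def field_simps)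
      moreover have "filterlim (\<lambda>t. 1 + c / (R1 + R2) * t) at_top at_top"
        by (rule filterlim_tendsto_add_at_top[OF tendsto_const],
            rule filterlim_tendsto_pos_mult_at_top[OF tendsto_const _ filterlim_ident])
           (use c R in simp)
      ultimately show ?thesis by (simp only:)
    qed
    hence "filterlim (\<lambda>t. ln (S t / (R1 + R2))) at_top at_top"
      by (rule filterlim_compose[OF ln_at_top])
    hence "filterlim (\<lambda>t. 1 / c * ln (S t / (R1 + R2))) at_top at_top"
      using filterlim_tendsto_pos_mult_at_top[OF tendsto_const[of "1 / c"]] c by auto
    thus ?thesis unfolding \<tau>_def by simp
  qed
  hence "(q \<longlongrightarrow> limit_ratio n) at_top" unfolding q_def by (rule filterlim_compose[OF y(3)])
  moreover have "\<forall>\<^sub>F t in at_top. q t = \<rho>1 t / \<rho>2 t"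
    using eventually_ge_at_top[of 0] by eventually_elim (simp add: ratio)
  ultimately have lim: "((\<lambda>t. \<rho>1 t / \<rho>2 t) \<longlongrightarrow> limit_ratio n) at_top" by (rule Lim_transform_eventually)
  show ?thesis
    by (rule exI[of _ \<rho>1], rule exI[of _ \<rho>2])
       (use init pos deriv lim sum q in \<open>force simp: S_def c_def\<close>)
qed

text \<open>For \<open>n = 2\<close> the sum satisfies \<open>S' = 4\<close> and the difference
  \<open>D' = 8 * S / D\<close>. Hence \<open>D^2 - 2 * S^2\<close> is constant and the squared
  radii are explicit.\<close>

lemma two_ring_radii_colliding:
  assumes R: "0 < R1" "R1 < R2"
  shows "\<exists>Tc \<rho>1 \<rho>2. 0 < Tc \<and> \<rho>1 0 = R1 \<and> \<rho>2 0 = R2 \<and>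
    (\<forall>t. 0 \<le> t \<and> t < Tc \<longrightarrow> 0 < \<rho>1 t \<and> \<rho>1 t < \<rho>2 t \<and>
      (\<rho>1 has_real_derivative - 2 - 8 * \<rho>1 t / (\<rho>2 t - \<rho>1 t)) (at t) \<and>
      (\<rho>2 has_real_derivative - 2 + 8 * \<rho>2 t / (\<rho>2 t - \<rho>1 t)) (at t)) \<and>
    continuous_on {0..Tc} \<rho>1 \<and> continuous_on {0..Tc} \<rho>2 \<and> \<rho>1 Tc = 0 \<and> 0 < \<rho>2 Tc"
proof -
  define S0 D0 where "S0 = R1 + R2" and "D0 = R2 - R1"
  \<comment> \<open>The collision \<open>\<rho>1 = 0\<close> means \<open>D = S\<close>, which the
    conserved quantity turns into \<open>S^2 = Q\<close>. Solving \<open>S0 + 4 * t = sqrt Q\<close>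
    gives \<open>Tc\<close>.\<close>
  define Q where "Q = 2 * S0\<^sup>2 - D0\<^sup>2"
  define Tc where "Tc = (sqrt Q - S0) / 4"
  define S where "S = (\<lambda>t. S0 + 4 * t)"
  define D where "D = (\<lambda>t. sqrt (D0\<^sup>2 + 2 * ((S t)\<^sup>2 - S0\<^sup>2)))"
  define \<rho>1 where "\<rho>1 = (\<lambda>t. (S t - D t) / 2)"
  define \<rho>2 where "\<rho>2 = (\<lambda>t. (S t + D t) / 2)"
  have SD: "0 < D0" "D0 < S0" using R by (auto simp: S0_def D0_def)
  have "D0\<^sup>2 < S0\<^sup>2" using SD by (intro power_strict_mono) auto
  hence Q: "S0\<^sup>2 < Q" by (simp add: Q_def)
  hence sQ: "S0 < sqrt Q" by (rule real_less_rsqrt)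
  have Q0: "0 < Q" using Q by (meson le_less_trans zero_le_power2)
  have Tc: "0 < Tc" using sQ by (simp add: Tc_def)
  have S: "S0 \<le> S t" "0 < S t" if "0 \<le> t" for t using that SD by (auto simp: S_def)
  have STc: "S Tc = sqrt Q" by (simp add: S_def Tc_def field_simps)
  have rad: "0 < D0\<^sup>2 + 2 * ((S t)\<^sup>2 - S0\<^sup>2)" if "0 \<le> t" for t
  proof -
    have "S0\<^sup>2 \<le> (S t)\<^sup>2" using S[OF that] SD by (intro power_mono) auto
    thus ?thesis using SD by (simp add: add_pos_nonneg)
  qed
  have D: "0 < D t" if "0 \<le> t" for t using rad[OF that] by (simp add: D_def)
  have D_less: "D t < S t" if "0 \<le> t" "t < Tc" for t
  proof -
    have "(S t)\<^sup>2 < (sqrt Q)\<^sup>2"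
      using that S[of t] STc by (intro power_strict_mono) (auto simp: S_def)
    hence "D0\<^sup>2 + 2 * ((S t)\<^sup>2 - S0\<^sup>2) < (S t)\<^sup>2" using Q0 by (simp add: Q_def)
    thus ?thesis unfolding D_def using S[of t] that by (intro real_less_lsqrt) auto
  qed
  have DTc: "D Tc = S Tc"
    unfolding D_def STc using Q0 by (simp add: Q_def)
  have dS: "(S has_real_derivative 4) (at t)" for t
    unfolding S_def by (auto intro!: derivative_eq_intros)
  have dD: "(D has_real_derivative 8 * S t / D t) (at t)" if "0 \<le> t" for t
    unfolding D_def using rad[OF that]
    by (auto intro!: derivative_eq_intros dS simp: field_simps)
  have diff: "\<rho>2 t - \<rho>1 t = D t" for t by (simp add: \<rho>1_def \<rho>2_def field_simps)
  have d1: "(\<rho>1 has_real_derivative - 2 - 8 * \<rho>1 t / (\<rho>2 t - \<rho>1 t)) (at t)" if "0 \<le> t" for t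
  proof -
    have "(\<rho>1 has_real_derivative (4 - 8 * S t / D t) / 2) (at t)"
      unfolding \<rho>1_def by (intro DERIV_cdivide DERIV_diff dS dD that)
    moreover have "(4 - 8 * S t / D t) / 2 = - 2 - 8 * \<rho>1 t / (\<rho>2 t - \<rho>1 t)"
      unfolding diff using D[OF that] by (simp add: \<rho>1_def field_simps)
    ultimately show ?thesis by (simp only:)
  qed
  have d2: "(\<rho>2 has_real_derivative - 2 + 8 * \<rho>2 t / (\<rho>2 t - \<rho>1 t)) (at t)" if "0 \<le> t" for t
  proof -
    have "(\<rho>2 has_real_derivative (4 + 8 * S t / D t) / 2) (at t)"
      unfolding \<rho>2_def by (intro DERIV_cdivide DERIV_add dS dD that)
    moreover have "(4 + 8 * S t / D t) / 2 = - 2 + 8 * \<rho>2 t / (\<rho>2 t - \<rho>1 t)"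
      unfolding diff using D[OF that] by (simp add: \<rho>2_def field_simps)
    ultimately show ?thesis by (simp only:)
  qed
  \<comment> \<open>The explicit formulas satisfy the equations for all \<open>t \<ge> 0\<close>, in
    particular at \<open>Tc\<close>, whence continuity on the closed interval.\<close>
  have cont: "continuous_on {0..Tc} \<rho>1" "continuous_on {0..Tc} \<rho>2"
    using d1 d2 by (auto intro!: DERIV_atLeastAtMost_imp_continuous_on)
  have pos: "0 < \<rho>1 t" "\<rho>1 t < \<rho>2 t" if "0 \<le> t" "t < Tc" for t
    using D_less[OF that] D[OF that(1)] by (auto simp: \<rho>1_def \<rho>2_def)
  have "\<rho>1 0 = R1" "\<rho>2 0 = R2" using SD by (auto simp: \<rho>1_def \<rho>2_def D_def S_def S0_def D0_def)
  moreover have "\<rho>1 Tc = 0" "0 < \<rho>2 Tc"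
    using D[of Tc] Tc S[of Tc] DTc by (auto simp: \<rho>1_def \<rho>2_def)
  ultimately show ?thesis using Tc cont pos d1 d2
    by (intro exI[of _ Tc] exI[of _ \<rho>1] exI[of _ \<rho>2]) simp
qed

section \<open>Large-time asymptotics of the squared radii\<close>

lemma asymp_equiv_linearI:
  fixes f :: "real \<Rightarrow> real"
  assumes "((\<lambda>t. f t / t) \<longlongrightarrow> a) at_top" "a \<noteq> 0"
  shows "f \<sim>[at_top] (\<lambda>t. a * t)"
proof (rule asymp_equivI')
  have "((\<lambda>t. (f t / t) / a) \<longlongrightarrow> a / a) at_top"
    by (intro tendsto_intros assms)
  thus "((\<lambda>t. f t / (a * t)) \<longlongrightarrow> 1) at_top"
    using assms(2) by (simp add: mult.commute)
qed

text \<open>Writing \<open>\<rho>2 / t\<close> as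
  \<open>((\<rho>1 + \<rho>2) / t) / (1 + \<rho>1 / \<rho>2)\<close> reduces the growth to the known
  sum and the limiting ratio.\<close>

lemma two_ring_growth:
  fixes \<rho>1 \<rho>2 :: "real \<Rightarrow> real"
  assumes sum: "\<And>t. 0 \<le> t \<Longrightarrow> 0 < \<rho>1 t \<and> 0 < \<rho>2 t \<and> \<rho>1 t + \<rho>2 t = S0 + c * t"
    and lim: "((\<lambda>t. \<rho>1 t / \<rho>2 t) \<longlongrightarrow> e) at_top" and e: "0 \<le> e"
  shows "((\<lambda>t. \<rho>1 t / t) \<longlongrightarrow> c * e / (1 + e)) at_top"
    and "((\<lambda>t. \<rho>2 t / t) \<longlongrightarrow> c / (1 + e)) at_top"
proof -
  have "((\<lambda>t::real. S0 / t) \<longlongrightarrow> 0) at_top"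
    by (rule tendsto_divide_0[OF tendsto_const filterlim_at_top_imp_at_infinity[OF filterlim_ident]])
  hence "((\<lambda>t. (S0 / t + c) / (1 + \<rho>1 t / \<rho>2 t)) \<longlongrightarrow> (0 + c) / (1 + e)) at_top"
    using e by (intro tendsto_intros lim) auto
  moreover have "\<forall>\<^sub>F t in at_top. (S0 / t + c) / (1 + \<rho>1 t / \<rho>2 t) = \<rho>2 t / t"
    using eventually_gt_at_top[of 0]
  proof eventually_elim
    case (elim t)
    have "1 + \<rho>1 t / \<rho>2 t = (\<rho>1 t + \<rho>2 t) / \<rho>2 t" "S0 / t + c = (\<rho>1 t + \<rho>2 t) / t"
      using sum[of t] elim by (auto simp: field_simps)
    thus ?case using sum[of t] elim by simp
  qed
  ultimately show 2: "((\<lambda>t. \<rho>2 t / t) \<longlongrightarrow> c / (1 + e)) at_top"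
    using Lim_transform_eventually by fastforce
  have "((\<lambda>t. \<rho>1 t / \<rho>2 t * (\<rho>2 t / t)) \<longlongrightarrow> e * (c / (1 + e))) at_top"
    by (intro tendsto_intros lim 2)
  moreover have "\<forall>\<^sub>F t in at_top. \<rho>1 t / \<rho>2 t * (\<rho>2 t / t) = \<rho>1 t / t"
    using eventually_gt_at_top[of 0]
  proof eventually_elim
    case (elim t)
    thus ?case using sum[of t] by simp
  qed
  ultimately have "((\<lambda>t. \<rho>1 t / t) \<longlongrightarrow> e * (c / (1 + e))) at_top"
    by (rule Lim_transform_eventually)
  thus "((\<lambda>t. \<rho>1 t / t) \<longlongrightarrow> c * e / (1 + e)) at_top" by (simp add: mult.commute)
qed

text \<open>The inverse radii have derivatives \<open>6 / (y^3 - x^3)\<close> and its negative,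
  where \<open>x\<close> and \<open>y\<close> are the inner and outer radius, so their sum keeps its
  initial value \<open>\<kappa>\<close>. As the outer radius tends to infinity, the inverse inner
  radius tends to \<open>\<kappa> = (a1 + a2) / (a1 * a2)\<close>.\<close>

lemma inner_radius_limit_three:
  fixes \<rho>1 \<rho>2 :: "real \<Rightarrow> real"
  assumes init: "\<rho>1 0 = a1\<^sup>2" "\<rho>2 0 = a2\<^sup>2" and a: "0 < a1" "0 < a2"
    and pos: "\<And>t. 0 \<le> t \<Longrightarrow> 0 < \<rho>1 t \<and> \<rho>1 t < \<rho>2 t"
    and d1: "\<And>t. 0 \<le> t \<Longrightarrow> (\<rho>1 has_real_derivative - 12 * sqrt (\<rho>1 t) ^ 3 / (sqrt (\<rho>2 t) ^ 3 - sqrt (\<rho>1 t) ^ 3)) (at t)"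
    and d2: "\<And>t. 0 \<le> t \<Longrightarrow> (\<rho>2 has_real_derivative 12 * sqrt (\<rho>2 t) ^ 3 / (sqrt (\<rho>2 t) ^ 3 - sqrt (\<rho>1 t) ^ 3)) (at t)"
    and inf: "filterlim \<rho>2 at_top at_top"
  shows "(\<rho>1 \<longlongrightarrow> (a1 * a2 / (a1 + a2))\<^sup>2) at_top"
proof -
  define \<kappa> where "\<kappa> = 1 / a1 + 1 / a2"
  let ?f = "\<lambda>t. inverse (sqrt (\<rho>1 t)) + inverse (sqrt (\<rho>2 t))"
  have const: "?f t = \<kappa>" if t: "0 \<le> t" for t
  proof -
    have "(?f has_real_derivative 0) (at s within {0..})" if "s \<in> {0..}" for s
    proof -
      define x y where "x = sqrt (\<rho>1 s)" and "y = sqrt (\<rho>2 s)"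
      have s: "0 \<le> s" "0 < \<rho>1 s" "0 < \<rho>2 s" "\<rho>1 s < \<rho>2 s" using that pos[of s] by auto
      have xy: "0 < x" "x < y" using s by (auto simp: x_def y_def)
      have ne: "x ^ 3 < y ^ 3" using xy by (intro power_strict_mono) auto
      have "((\<lambda>t. inverse (sqrt (\<rho>1 t))) has_real_derivative
          - (inverse x * (inverse x / 2 * (- 12 * x ^ 3 / (y ^ 3 - x ^ 3))) * inverse x)) (at s)"
        using DERIV_inverse'[OF DERIV_chain2[OF DERIV_real_sqrt[OF s(2)] d1[OF s(1)]]] s xy
        unfolding x_def y_def by simp
      also have "- (inverse x * (inverse x / 2 * (- 12 * x ^ 3 / (y ^ 3 - x ^ 3))) * inverse x) = 6 / (y ^ 3 - x ^ 3)"
        using xy ne by (simp add: divide_simps power3_eq_cube)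
      finally have 1: "((\<lambda>t. inverse (sqrt (\<rho>1 t))) has_real_derivative 6 / (y ^ 3 - x ^ 3)) (at s)" .
      have "((\<lambda>t. inverse (sqrt (\<rho>2 t))) has_real_derivative
          - (inverse y * (inverse y / 2 * (12 * y ^ 3 / (y ^ 3 - x ^ 3))) * inverse y)) (at s)"
        using DERIV_inverse'[OF DERIV_chain2[OF DERIV_real_sqrt[OF s(3)] d2[OF s(1)]]] s xy
        unfolding x_def y_def by simp
      also have "- (inverse y * (inverse y / 2 * (12 * y ^ 3 / (y ^ 3 - x ^ 3))) * inverse y) = - (6 / (y ^ 3 - x ^ 3))"
        using xy ne by (simp add: divide_simps power3_eq_cube)
      finally have 2: "((\<lambda>t. inverse (sqrt (\<rho>2 t))) has_real_derivative - (6 / (y ^ 3 - x ^ 3))) (at s)" .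
      show ?thesis using DERIV_add[OF 1 2] by (simp add: has_field_derivative_at_within)
    qed
    from has_field_derivative_zero_constant[OF convex_real_interval(1) this] obtain k where
      "\<And>s. s \<in> {0..} \<Longrightarrow> ?f s = k" by blast
    from this[of t] this[of 0] t show ?thesis
      using a by (simp add: init \<kappa>_def inverse_eq_divide)
  qed
  have "filterlim (\<lambda>t. sqrt (\<rho>2 t)) at_top at_top"
    by (rule filterlim_compose[OF sqrt_at_top inf])
  hence "((\<lambda>t. inverse (sqrt (\<rho>2 t))) \<longlongrightarrow> 0) at_top"
    by (rule filterlim_compose[OF tendsto_inverse_0_at_top[OF filterlim_ident]])
  hence "((\<lambda>t. inverse ((\<kappa> - inverse (sqrt (\<rho>2 t)))\<^sup>2)) \<longlongrightarrow> inverse ((\<kappa> - 0)\<^sup>2)) at_top"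
    using a by (intro tendsto_intros) (auto simp: \<kappa>_def add_pos_pos less_imp_neq[symmetric])
  moreover have "\<forall>\<^sub>F t in at_top. inverse ((\<kappa> - inverse (sqrt (\<rho>2 t)))\<^sup>2) = \<rho>1 t"
    using eventually_ge_at_top[of 0]
  proof eventually_elim
    case (elim t)
    have "\<kappa> - inverse (sqrt (\<rho>2 t)) = inverse (sqrt (\<rho>1 t))" using const[OF elim] by simp
    thus ?case using pos[OF elim] by (simp add: power_inverse)
  qed
  ultimately have "(\<rho>1 \<longlongrightarrow> inverse ((\<kappa> - 0)\<^sup>2)) at_top" by (rule Lim_transform_eventually)
  moreover have "inverse (\<kappa>\<^sup>2) = (a1 * a2 / (a1 + a2))\<^sup>2"
  proof -
    have "inverse \<kappa> = a1 * a2 / (a1 + a2)" using a by (simp add: \<kappa>_def field_simps)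
    thus ?thesis by (simp only: flip: power_inverse)
  qed
  ultimately show ?thesis by simp
qed

text \<open>With \<open>p = sqrt q ^ n \<ge> 0\<close> replaced by 0, the drift equation becomes the
  inequality \<open>4 n q \<le> 2 (n - 3) (1 - q)\<close>, hence
  \<open>q \<le> (n - 3) / (3 (n - 1))\<close>. The bound makes \<open>p\<close> exponentially small
  in \<open>n\<close>.\<close>

lemma limit_ratio_le_third:
  assumes "3 \<le> n"
  shows "limit_ratio n \<le> 1 / 3"
proof -
  let ?q = "limit_ratio n"
  let ?p = "sqrt ?q ^ n"
  note q = limit_ratio[OF assms]
  have p: "0 \<le> ?p" using q by simp
  have "4 * real n * ?q \<le> 4 * real n * (?p + ?q)" using p by (intro mult_left_mono) auto
  also have "\<dots> = 2 * (real n - 3) * ((1 - ?q) * (1 - ?p))" using q(3) by (simp add: ratio_drift_def)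
  also have "\<dots> \<le> 2 * (real n - 3) * ((1 - ?q) * 1)"
    using p q assms by (intro mult_left_mono) auto
  finally have "(6 * real n - 6) * ?q \<le> 2 * real n - 6" by (simp add: algebra_simps)
  also have "\<dots> \<le> (6 * real n - 6) * (1 / 3)" by simp
  finally show ?thesis using assms by (subst (asm) mult_le_cancel_left) auto
qed

section \<open>Growth rates of the squared radii\<close>

lemma powr_half_eq_sqrt_power: "0 < b \<Longrightarrow> b powr (real n / 2) = sqrt b ^ n"
  by (simp add: powr_half_sqrt[symmetric] powr_powr flip: powr_realpow)

text \<open>Together with \<open>outer_rate\<close> this divides the slope \<open>8 * n - 12\<close>
  of the sum in the proportion \<open>limit_ratio n\<close> to 1.\<close>

definition inner_rate :: "nat \<Rightarrow> real" where
  "inner_rate n = (8 * real n - 12) * limit_ratio n / (1 + limit_ratio n)"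

definition outer_rate :: "nat \<Rightarrow> real" where
  "outer_rate n = (8 * real n - 12) / (1 + limit_ratio n)"

lemma inner_rate_add_outer_rate:
  assumes "3 \<le> n" shows "inner_rate n + outer_rate n = 8 * real n - 12"
proof -
  have "inner_rate n + outer_rate n = (8 * real n - 12) * (1 + limit_ratio n) / (1 + limit_ratio n)"
    by (simp add: inner_rate_def outer_rate_def add_divide_distrib distrib_left)
  thus ?thesis using limit_ratio[OF assms] by simp
qed

text \<open>Because \<open>inner_rate n = q * outer_rate n\<close>, the quotient of powers is
  \<open>(1 + p) / (1 - p)\<close> with \<open>p = sqrt q ^ n\<close>. Cleared of denominators, the
  last equation is then \<open>2 * ratio_drift n q = 0\<close>.\<close>

lemma rates:
  assumes n: "4 \<le> n"
  shows "0 < inner_rate n" "inner_rate n < outer_rate n"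
    "outer_rate n - inner_rate n =
          4 * real n * ((outer_rate n powr (real n / 2) + inner_rate n powr (real n / 2)) /
                        (outer_rate n powr (real n / 2) - inner_rate n powr (real n / 2)))"
proof -
  define q where "q = limit_ratio n"
  define p where "p = sqrt q ^ n"
  have q: "0 < q" "q < 1" and drift: "ratio_drift n q = 0"
    using limit_ratio[of n] limit_ratio_pos[OF n] n by (auto simp: q_def)
  have p: "p < 1" using power_strict_mono[of "sqrt q" 1 n] q n by (simp add: p_def)
  have inner: "inner_rate n = q * outer_rate n" by (simp add: inner_rate_def outer_rate_def q_def)
  have outer: "0 < outer_rate n" using q n by (simp add: outer_rate_def q_def)
  show pos: "0 < inner_rate n" "inner_rate n < outer_rate n" using inner outer q by auto
  define x where "x = sqrt (outer_rate n) ^ n"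
  have x: "0 < x" using outer by (simp add: x_def)
  have pw: "outer_rate n powr (real n / 2) = x" "inner_rate n powr (real n / 2) = p * x"
    using outer pos q by (auto simp: powr_half_eq_sqrt_power x_def p_def inner real_sqrt_mult power_mult_distrib)
  have "(x + p * x) / (x - p * x) = ((1 + p) * x) / ((1 - p) * x)" by (simp add: algebra_simps)
  also have "\<dots> = (1 + p) / (1 - p)" using x by simp
  finally have frac: "(x + p * x) / (x - p * x) = (1 + p) / (1 - p)" .
  have "(8 * real n - 12) * (1 - q) * (1 - p) - 4 * real n * ((1 + p) * (1 + q)) = 2 * ratio_drift n q"
    by (simp add: ratio_drift_def p_def[symmetric] algebra_simps)
  hence eq: "(8 * real n - 12) * (1 - q) * (1 - p) = 4 * real n * ((1 + p) * (1 + q))" using drift by simp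
  have "outer_rate n - inner_rate n = (8 * real n - 12) * (1 - q) / (1 + q)"
  proof -
    have "outer_rate n - inner_rate n = (1 - q) * outer_rate n" unfolding inner by (simp add: algebra_simps)
    thus ?thesis by (simp add: outer_rate_def q_def mult.commute)
  qed
  also have "\<dots> = 4 * real n * ((1 + p) / (1 - p))"
    using eq p q by (simp add: frac_eq_eq)
  finally show "outer_rate n - inner_rate n =
          4 * real n * ((outer_rate n powr (real n / 2) + inner_rate n powr (real n / 2)) /
                        (outer_rate n powr (real n / 2) - inner_rate n powr (real n / 2)))"
    unfolding pw frac .
qed

text \<open>If \<open>p\<close> were 0 in the drift equation, the rate would be exactly
  \<open>2 * n - 6\<close>. The true error has absolute value \<open>p * w / (1 + q)\<close>, at
  most \<open>6 * n\<close> times the \<open>n\<close>-th power of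
  \<open>sqrt (1 / 3)\<close>.\<close>

lemma inner_rate_asymptotics: "(\<lambda>n. inner_rate n - (2 * real n - 6)) \<longlonglongrightarrow> 0"
proof (rule tendsto_0_le)
  show "(\<lambda>n. real n * sqrt (1 / 3) ^ n) \<longlonglongrightarrow> 0"
    by (rule powser_times_n_limit_0) simp
  show "\<forall>\<^sub>F n in sequentially. norm (inner_rate n - (2 * real n - 6)) \<le> norm (real n * sqrt (1 / 3) ^ n) * 6"
    using eventually_ge_at_top[of 3]
  proof eventually_elim
    case (elim n)
    define q where "q = limit_ratio n"
    define p where "p = sqrt q ^ n"
    have q: "0 \<le> q" "q \<le> 1 / 3" and drift: "ratio_drift n q = 0"
      using limit_ratio[OF elim] limit_ratio_le_third[OF elim] by (auto simp: q_def)
    have p: "0 \<le> p" "p \<le> sqrt (1 / 3) ^ n" unfolding p_def using q by (auto intro!: power_mono)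
    \<comment> \<open>\<open>- w\<close> is the coefficient of \<open>p\<close> in the
      drift.\<close>
    define w where "w = 4 * real n + 2 * (real n - 3) * (1 - q)"
    have "inner_rate n - (2 * real n - 6) = ((8 * real n - 12) * q - (2 * real n - 6) * (1 + q)) / (1 + q)"
      using q by (simp add: inner_rate_def q_def[symmetric] diff_divide_distrib)
    also have "(8 * real n - 12) * q - (2 * real n - 6) * (1 + q) = - p * w - ratio_drift n q"
      by (simp add: ratio_drift_def p_def[symmetric] w_def algebra_simps)
    finally have e: "inner_rate n - (2 * real n - 6) = - (p * w / (1 + q))" using drift by simp
    have "(real n - 3) * (1 - q) \<le> real n * 1" using q elim by (intro mult_mono) auto
    moreover have "0 \<le> (real n - 3) * (1 - q)" using q elim by simp
    moreover have "w = 4 * real n + 2 * ((real n - 3) * (1 - q))" by (simp add: w_def)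
    ultimately have w: "0 \<le> w" "w \<le> 6 * real n" by linarith+
    have "p * w / (1 + q) \<le> p * w / 1" using p w q by (intro divide_left_mono) auto
    also have "\<dots> \<le> sqrt (1 / 3) ^ n * (6 * real n)" using p w by simp (intro mult_mono, auto)
    finally show ?case using p w q unfolding e by (simp add: mult_ac)
  qed
qed

section \<open>The initial value problem\<close>

locale vortex_double_ring =
  fixes n :: nat and m :: "nat \<Rightarrow> int" and m0 :: int and \<theta>0 a1 a2 :: real and x0 :: "nat \<Rightarrow> real^2"
  assumes n: "2 \<le> n" and m0: "m0 \<in> {1, -1}" and m_center: "m (2 * n + 1) = - m0"
    and m_rings: "\<forall>j\<in>{1..2*n}. m j = m0" and a: "0 < a1" "a1 < a2"
    and center: "x0 (2 * n + 1) = 0"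
    and rings: "\<forall>j\<in>{1..n}. x0 j = a1 *\<^sub>R ring_direction n \<theta>0 j \<and>
                            x0 (n + j) = a2 *\<^sub>R ring_direction n \<theta>0 j"
begin

lemma initial_double_ring: "j \<in> {1..2*n+1} \<Longrightarrow> x0 j = double_ring n \<theta>0 a1 a2 j"
  by (erule double_ring_index_cases) (use center rings in auto)

lemma squares: "0 < a1\<^sup>2" "a1\<^sup>2 < a2\<^sup>2"
  using a by (auto intro!: power_strict_mono)

text \<open>The inner ring and the center meet at the origin when \<open>\<rho>1\<close> vanishes.
  At that moment \<open>\<rho>2\<close> is still positive, which keeps vortices 3 and 4 away from
  the cluster.\<close>

lemma colliding_double_ring:
  assumes n2: "n = 2"
  shows "\<exists>Tc \<rho>1 \<rho>2. let x = (\<lambda>j t. double_ring n \<theta>0 (sqrt (\<rho>1 t)) (sqrt (\<rho>2 t)) j) in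
    the_vortex_solution (2 * n + 1) m x0 (ereal Tc) x \<and>
    (\<forall>t. 0 \<le> t \<and> t < Tc \<longrightarrow> 0 < \<rho>1 t \<and> 0 < \<rho>2 t) \<and>
    collision_cluster_at (2 * n + 1) x {1, 2, 5} Tc 0"
proof -
  obtain Tc \<rho>1 \<rho>2 where Tc: "0 < Tc" and init: "\<rho>1 0 = a1\<^sup>2" "\<rho>2 0 = a2\<^sup>2" and
    ode: "\<forall>t. 0 \<le> t \<and> t < Tc \<longrightarrow> 0 < \<rho>1 t \<and> \<rho>1 t < \<rho>2 t \<and>
      (\<rho>1 has_real_derivative - 2 - 8 * \<rho>1 t / (\<rho>2 t - \<rho>1 t)) (at t) \<and>
      (\<rho>2 has_real_derivative - 2 + 8 * \<rho>2 t / (\<rho>2 t - \<rho>1 t)) (at t)" and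
    cont: "continuous_on {0..Tc} \<rho>1" "continuous_on {0..Tc} \<rho>2" and
    final: "\<rho>1 Tc = 0" "0 < \<rho>2 Tc"
    using two_ring_radii_colliding[OF squares] by (elim exE conjE) (rule that)
  define x where "x = (\<lambda>j t. double_ring n \<theta>0 (sqrt (\<rho>1 t)) (sqrt (\<rho>2 t)) j)"
  have pos: "0 < \<rho>1 t" "\<rho>1 t < \<rho>2 t" if "0 \<le> t" "t < Tc" for t using ode that by auto
  have sol: "vortex_solution (2 * n + 1) m x0 (ereal Tc) x"
    unfolding x_def
  proof (rule double_ring_vortex_solution[OF n m0 m_center m_rings])
    have sub: "{t. 0 \<le> t \<and> ereal t < ereal Tc} \<subseteq> {0..Tc}" by auto
    show "continuous_on {t. 0 \<le> t \<and> ereal t < ereal Tc} \<rho>1" "continuous_on {t. 0 \<le> t \<and> ereal t < ereal Tc} \<rho>2"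
      by (rule continuous_on_subset[OF cont(1) sub], rule continuous_on_subset[OF cont(2) sub])
  next
    fix t assume "0 < t" "ereal t < ereal Tc"
    hence t: "0 \<le> t" "t < Tc" by auto
    \<comment> \<open>For \<open>n = 2\<close> these powers are the squared radii themselves, so the
      general equations become those of \<open>two_ring_radii_colliding\<close>.\<close>
    have sq: "sqrt (\<rho>1 t) ^ n = \<rho>1 t" "sqrt (\<rho>2 t) ^ n = \<rho>2 t" using pos[OF t] by (auto simp: n2)
    show "(\<rho>1 has_real_derivative 2 * (real n - 3) - 4 * real n * sqrt (\<rho>1 t) ^ n / (sqrt (\<rho>2 t) ^ n - sqrt (\<rho>1 t) ^ n)) (at t)"
      and "(\<rho>2 has_real_derivative 2 * (real n - 3) + 4 * real n * sqrt (\<rho>2 t) ^ n / (sqrt (\<rho>2 t) ^ n - sqrt (\<rho>1 t) ^ n)) (at t)"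
      unfolding sq using ode t by (auto simp: n2)
  qed (use Tc pos initial_double_ring init a in auto)
  have contx: "continuous_on {0..Tc} (x j)" for j
    unfolding x_def double_ring_def
    by (cases "j \<le> n"; cases "j \<le> 2 * n") (auto intro!: continuous_intros cont)
  have at_Tc: "x j Tc = 0" if "j \<in> {1, 2, 5}" for j
    using that n2 final(1) by (auto simp: x_def double_ring_def)
  have inj: "inj_on (\<lambda>j. x j t) {1..2 * n + 1}" if "0 \<le> t" "t < Tc" for t
    using sol that by (simp add: vortex_solution_def)
  have "the_vortex_solution (2 * n + 1) m x0 (ereal Tc) x"
    \<comment> \<open>Vortices 1 and 5 coincide at \<open>Tc\<close>, which certifies that no
      solution lives longer.\<close>
    by (rule the_vortex_solution_collision[OF sol contx contx, of 1 5]) (use at_Tc n2 in auto)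
  moreover have "collision_cluster_at (2 * n + 1) x {1, 2, 5} Tc 0"
    unfolding collision_cluster_at_def
  proof (intro conjI ballI allI impI)
    fix t j l assume t: "0 \<le> t \<and> t < Tc" and jl: "1 \<le> j \<and> j < l \<and> l \<le> 2 * n + 1"
    have "x j t \<noteq> x l t" using inj_onD[OF inj, of t j l] t jl by auto
    thus "0 < norm (x j t - x l t)" by simp
  next
    fix j :: nat assume "j \<in> {1, 2, 5}"
    thus "(x j \<longlongrightarrow> 0) (at_left Tc)"
      using continuous_on_Icc_at_leftD[OF contx Tc, of j] at_Tc by simp
  next
    fix l t j assume l: "l \<in> {1..2 * n + 1} - {1, 2, 5}" and t: "0 \<le> t \<and> t \<le> Tc" and j: "j \<in> {1, 2, 5 :: nat}"
    have "x j t \<noteq> x l t"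
    proof (cases "t = Tc")
      case True
      have "l = 3 \<or> l = 4" using l n2 by auto
      hence "x l Tc \<noteq> 0" using n2 final(2) by (auto simp: x_def double_ring_def)
      thus ?thesis using True at_Tc[OF j] by simp
    next
      case False
      thus ?thesis using inj_onD[OF inj, of t j l] t j l n2 by auto
    qed
    thus "0 < norm (x j t - x l t)" by simp
  qed (use n2 Tc contx in auto)
  moreover have "\<forall>t. 0 \<le> t \<and> t < Tc \<longrightarrow> 0 < \<rho>1 t \<and> 0 < \<rho>2 t"
    using pos by (meson less_trans)
  ultimately show ?thesis
    unfolding x_def Let_def
    by (intro exI[of _ Tc] exI[of _ \<rho>1] exI[of _ \<rho>2] conjI)
qed

lemma global_double_ring:
  assumes n3: "3 \<le> n"
  shows "\<exists>\<rho>1 \<rho>2. the_vortex_solution (2 * n + 1) m x0 \<infinity> (\<lambda>j t. double_ring n \<theta>0 (sqrt (\<rho>1 t)) (sqrt (\<rho>2 t)) j) \<and>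
    (\<forall>t\<ge>0. 0 < \<rho>1 t \<and> 0 < \<rho>2 t) \<and>
    (n = 3 \<longrightarrow> \<rho>1 \<sim>[at_top] (\<lambda>t. (a1 * a2 / (a1 + a2))\<^sup>2) \<and> \<rho>2 \<sim>[at_top] (\<lambda>t. 12 * t)) \<and>
    (4 \<le> n \<longrightarrow> \<rho>1 \<sim>[at_top] (\<lambda>t. inner_rate n * t) \<and> \<rho>2 \<sim>[at_top] (\<lambda>t. outer_rate n * t))"
proof -
  obtain \<rho>1 \<rho>2 where init: "\<rho>1 0 = a1\<^sup>2" "\<rho>2 0 = a2\<^sup>2" and
    ode: "\<forall>t\<ge>0. 0 < \<rho>1 t \<and> \<rho>1 t < \<rho>2 t \<and>
      \<rho>1 t + \<rho>2 t = a1\<^sup>2 + a2\<^sup>2 + (8 * real n - 12) * t \<and>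
      (\<rho>1 has_real_derivative 2 * (real n - 3) - 4 * real n * sqrt (\<rho>1 t) ^ n / (sqrt (\<rho>2 t) ^ n - sqrt (\<rho>1 t) ^ n)) (at t) \<and>
      (\<rho>2 has_real_derivative 2 * (real n - 3) + 4 * real n * sqrt (\<rho>2 t) ^ n / (sqrt (\<rho>2 t) ^ n - sqrt (\<rho>1 t) ^ n)) (at t)" and
    lim: "((\<lambda>t. \<rho>1 t / \<rho>2 t) \<longlongrightarrow> limit_ratio n) at_top"
    using two_ring_radii[OF n3 squares] by (elim exE conjE) (rule that)
  have pos: "0 < \<rho>1 t \<and> \<rho>1 t < \<rho>2 t" if "0 \<le> t" for t using ode that by blast
  have d1: "(\<rho>1 has_real_derivative 2 * (real n - 3) - 4 * real n * sqrt (\<rho>1 t) ^ n / (sqrt (\<rho>2 t) ^ n - sqrt (\<rho>1 t) ^ n)) (at t)"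
    and d2: "(\<rho>2 has_real_derivative 2 * (real n - 3) + 4 * real n * sqrt (\<rho>2 t) ^ n / (sqrt (\<rho>2 t) ^ n - sqrt (\<rho>1 t) ^ n)) (at t)"
    if "0 \<le> t" for t using ode that by blast+
  have "vortex_solution (2 * n + 1) m x0 \<infinity> (\<lambda>j t. double_ring n \<theta>0 (sqrt (\<rho>1 t)) (sqrt (\<rho>2 t)) j)"
  proof (rule double_ring_vortex_solution[OF n m0 m_center m_rings])
    show "continuous_on {t. 0 \<le> t \<and> ereal t < \<infinity>} \<rho>1" "continuous_on {t. 0 \<le> t \<and> ereal t < \<infinity>} \<rho>2"
      using d1 d2 by (auto intro!: continuous_at_imp_continuous_on DERIV_isCont)
  qed (use pos d1 d2 initial_double_ring init a in \<open>simp_all add: zero_ereal_def\<close>)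
  hence sol: "the_vortex_solution (2 * n + 1) m x0 \<infinity> (\<lambda>j t. double_ring n \<theta>0 (sqrt (\<rho>1 t)) (sqrt (\<rho>2 t)) j)"
    by (rule the_vortex_solution_global)
  have sum: "0 < \<rho>1 t \<and> 0 < \<rho>2 t \<and> \<rho>1 t + \<rho>2 t = (a1\<^sup>2 + a2\<^sup>2) + (8 * real n - 12) * t" if "0 \<le> t" for t
    using ode that by force
  note growth = two_ring_growth[OF sum lim limit_ratio_nonneg[OF n3]]
  have outer: "\<rho>2 \<sim>[at_top] (\<lambda>t. outer_rate n * t)"
    by (rule asymp_equiv_linearI) (use growth(2) n3 limit_ratio_nonneg[OF n3] in \<open>auto simp: outer_rate_def\<close>)
  have three: "\<rho>1 \<sim>[at_top] (\<lambda>t. (a1 * a2 / (a1 + a2))\<^sup>2) \<and> \<rho>2 \<sim>[at_top] (\<lambda>t. 12 * t)" if "n = 3"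
  proof
    \<comment> \<open>Here \<open>8 * n - 12 = 12\<close> and the limiting ratio is 0, so the outer
      ring receives the whole slope.\<close>
    show 12: "\<rho>2 \<sim>[at_top] (\<lambda>t. 12 * t)"
      using outer that by (simp add: outer_rate_def limit_ratio_3)
    have unbounded: "filterlim \<rho>2 at_top at_top"
    proof (rule asymp_equiv_at_top_transfer[OF asymp_equiv_symI[OF 12]])
      show "filterlim (\<lambda>t::real. 12 * t) at_top at_top"
        by (rule filterlim_tendsto_pos_mult_at_top[OF tendsto_const _ filterlim_ident]) simp
    qed
    have "(\<rho>1 \<longlongrightarrow> (a1 * a2 / (a1 + a2))\<^sup>2) at_top"
      by (rule inner_radius_limit_three[where ?\<rho>2.0 = \<rho>2]) (use init d1 d2 pos unbounded that a in auto)
    thus "\<rho>1 \<sim>[at_top] (\<lambda>t. (a1 * a2 / (a1 + a2))\<^sup>2)"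
      by (rule tendsto_imp_asymp_equiv_const) (use a in auto)
  qed
  have inner: "\<rho>1 \<sim>[at_top] (\<lambda>t. inner_rate n * t)" if "4 \<le> n"
    by (rule asymp_equiv_linearI)
       (use growth(1)[folded inner_rate_def] rates(1)[OF that] in auto)
  show ?thesis
    by (rule exI[of _ \<rho>1], rule exI[of _ \<rho>2]) (use sol sum three inner outer in blast)
qed

end

text \<open>\<open>\<alpha>5\<close> and \<open>\<beta>5\<close> are quantified before all other
  data, so they depend on \<open>n\<close> alone. The approximations for large \<open>n\<close> are
  stated in the strong form that the differences tend to 0, and for \<open>n = 2\<close> the
  collision time is the lifespan.\<close>

theorem proposition4p6:
  "\<exists>\<alpha>5 \<beta>5 :: nat \<Rightarrow> real.
     (\<forall>(n::nat) (N::nat) (m0::int) (m :: nat \<Rightarrow> int) (\<theta>0::real) (a1::real) (a2::real)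
        (x0 :: nat \<Rightarrow> real^2).
        2 \<le> n \<longrightarrow> N = 2 * n + 1 \<longrightarrow>
        m0 \<in> {1, -1} \<longrightarrow> m N = - m0 \<longrightarrow> (\<forall>j\<in>{1..2*n}. m j = m0) \<longrightarrow>
        0 \<le> \<theta>0 \<longrightarrow> \<theta>0 < 2 * pi \<longrightarrow> 0 < a1 \<longrightarrow> a1 < a2 \<longrightarrow>
        x0 N = 0 \<longrightarrow>
        (\<forall>j\<in>{1..n}. x0 j = a1 *\<^sub>R ring_direction n \<theta>0 j \<and>
                     x0 (n + j) = a2 *\<^sub>R ring_direction n \<theta>0 j) \<longrightarrow>
        (\<exists>(T::ereal) (x :: nat \<Rightarrow> real \<Rightarrow> real^2) (\<rho>1 :: real \<Rightarrow> real) (\<rho>2 :: real \<Rightarrow> real).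
           the_vortex_solution N m x0 T x \<and>
           (\<forall>t. 0 \<le> t \<and> ereal t < T \<longrightarrow>
              0 < \<rho>1 t \<and> 0 < \<rho>2 t \<and>
              x N t = 0 \<and>
              (\<forall>j\<in>{1..n}. x j t = sqrt (\<rho>1 t) *\<^sub>R ring_direction n \<theta>0 j \<and>
                           x (n + j) t = sqrt (\<rho>2 t) *\<^sub>R ring_direction n \<theta>0 j)) \<and>
           (n = 2 \<longrightarrow> (\<exists>Tc. T = ereal Tc \<and> collision_cluster_at N x {1, 2, 5} Tc 0)) \<and>
           (n = 3 \<longrightarrow> T = \<infinity> \<and>
              \<rho>1 \<sim>[at_top] (\<lambda>t. (a1 * a2 / (a1 + a2))\<^sup>2) \<and>
              \<rho>2 \<sim>[at_top] (\<lambda>t. 12 * t)) \<and>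
           (n \<ge> 4 \<longrightarrow> T = \<infinity> \<and>
              \<rho>1 \<sim>[at_top] (\<lambda>t. \<alpha>5 n * t) \<and>
              \<rho>2 \<sim>[at_top] (\<lambda>t. \<beta>5 n * t)))) \<and>
     (\<forall>n\<ge>4.
        0 < \<alpha>5 n \<and> \<alpha>5 n < \<beta>5 n \<and>
        \<alpha>5 n + \<beta>5 n = 8 * real n - 12 \<and>
        \<beta>5 n - \<alpha>5 n =
          4 * real n * ((\<beta>5 n powr (real n / 2) + \<alpha>5 n powr (real n / 2)) /
                        (\<beta>5 n powr (real n / 2) - \<alpha>5 n powr (real n / 2)))) \<and>
     (\<lambda>n. \<alpha>5 n - (2 * real n - 6)) \<longlonglongrightarrow> 0 \<and>
     (\<lambda>n. \<beta>5 n - (6 * real n - 6)) \<longlonglongrightarrow> 0"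
proof (rule exI[of _ inner_rate], rule exI[of _ outer_rate], intro conjI allI impI)
  fix n N :: nat and m0 :: int and m :: "nat \<Rightarrow> int" and \<theta>0 a1 a2 :: real and x0 :: "nat \<Rightarrow> real^2"
  assume n: "2 \<le> n" and N: "N = 2 * n + 1" and hyps: "m0 \<in> {1, -1}" "m N = - m0" "\<forall>j\<in>{1..2*n}. m j = m0"
    "0 < a1" "a1 < a2" "x0 N = 0"
    "\<forall>j\<in>{1..n}. x0 j = a1 *\<^sub>R ring_direction n \<theta>0 j \<and> x0 (n + j) = a2 *\<^sub>R ring_direction n \<theta>0 j"
  interpret vortex_double_ring n m m0 \<theta>0 a1 a2 x0
    by unfold_locales (use n hyps N in auto)
  let ?x = "\<lambda>\<rho>1 \<rho>2 j t. double_ring n \<theta>0 (sqrt (\<rho>1 t)) (sqrt (\<rho>2 t)) j"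
  have config: "double_ring n \<theta>0 r R N = 0"
    "\<And>j. j \<in> {1..n} \<Longrightarrow> double_ring n \<theta>0 r R j = r *\<^sub>R ring_direction n \<theta>0 j \<and>
      double_ring n \<theta>0 r R (n + j) = R *\<^sub>R ring_direction n \<theta>0 j" for r R
    by (simp_all add: N)
  show "\<exists>(T::ereal) (x :: nat \<Rightarrow> real \<Rightarrow> real^2) (\<rho>1 :: real \<Rightarrow> real) (\<rho>2 :: real \<Rightarrow> real).
           the_vortex_solution N m x0 T x \<and>
           (\<forall>t. 0 \<le> t \<and> ereal t < T \<longrightarrow>
              0 < \<rho>1 t \<and> 0 < \<rho>2 t \<and>
              x N t = 0 \<and>
              (\<forall>j\<in>{1..n}. x j t = sqrt (\<rho>1 t) *\<^sub>R ring_direction n \<theta>0 j \<and>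
                           x (n + j) t = sqrt (\<rho>2 t) *\<^sub>R ring_direction n \<theta>0 j)) \<and>
           (n = 2 \<longrightarrow> (\<exists>Tc. T = ereal Tc \<and> collision_cluster_at N x {1, 2, 5} Tc 0)) \<and>
           (n = 3 \<longrightarrow> T = \<infinity> \<and>
              \<rho>1 \<sim>[at_top] (\<lambda>t. (a1 * a2 / (a1 + a2))\<^sup>2) \<and>
              \<rho>2 \<sim>[at_top] (\<lambda>t. 12 * t)) \<and>
           (n \<ge> 4 \<longrightarrow> T = \<infinity> \<and>
              \<rho>1 \<sim>[at_top] (\<lambda>t. inner_rate n * t) \<and>
              \<rho>2 \<sim>[at_top] (\<lambda>t. outer_rate n * t))"
  proof (cases "n = 2")
    case True
    obtain Tc \<rho>1 \<rho>2 where sol: "the_vortex_solution N m x0 (ereal Tc) (?x \<rho>1 \<rho>2)"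
      "\<forall>t. 0 \<le> t \<and> t < Tc \<longrightarrow> 0 < \<rho>1 t \<and> 0 < \<rho>2 t"
      "collision_cluster_at N (?x \<rho>1 \<rho>2) {1, 2, 5} Tc 0"
      using colliding_double_ring[OF True, unfolded Let_def, folded N] by (elim exE conjE) (rule that)
    show ?thesis
      by (rule exI[of _ "ereal Tc"], rule exI[of _ "?x \<rho>1 \<rho>2"], rule exI[of _ \<rho>1], rule exI[of _ \<rho>2])
         (use sol True config in auto)
  next
    case False
    hence n3: "3 \<le> n" using n by simp
    obtain \<rho>1 \<rho>2 where sol: "the_vortex_solution N m x0 \<infinity> (?x \<rho>1 \<rho>2)" "\<forall>t\<ge>0. 0 < \<rho>1 t \<and> 0 < \<rho>2 t"
      "n = 3 \<longrightarrow> \<rho>1 \<sim>[at_top] (\<lambda>t. (a1 * a2 / (a1 + a2))\<^sup>2) \<and> \<rho>2 \<sim>[at_top] (\<lambda>t. 12 * t)"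
      "4 \<le> n \<longrightarrow> \<rho>1 \<sim>[at_top] (\<lambda>t. inner_rate n * t) \<and> \<rho>2 \<sim>[at_top] (\<lambda>t. outer_rate n * t)"
      using global_double_ring[OF n3, folded N] by (elim exE conjE) (rule that)
    show ?thesis
      by (rule exI[of _ "\<infinity> :: ereal"], rule exI[of _ "?x \<rho>1 \<rho>2"], rule exI[of _ \<rho>1], rule exI[of _ \<rho>2])
         (use sol False config in auto)
  qed
next
  show "(\<lambda>n. inner_rate n - (2 * real n - 6)) \<longlonglongrightarrow> 0" by (rule inner_rate_asymptotics)
  \<comment> \<open>The rates add up to \<open>8 * n - 12 = (2 * n - 6) + (6 * n - 6)\<close>, so
    the outer error is the negative of the inner one.\<close>
  have "(\<lambda>n. - (inner_rate n - (2 * real n - 6))) \<longlonglongrightarrow> 0"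
    using tendsto_minus[OF inner_rate_asymptotics] by simp
  moreover have "\<forall>\<^sub>F n in sequentially. - (inner_rate n - (2 * real n - 6)) = outer_rate n - (6 * real n - 6)"
    using eventually_ge_at_top[of 3]
  proof eventually_elim
    case (elim n)
    thus ?case using inner_rate_add_outer_rate[of n] by simp
  qed
  ultimately show "(\<lambda>n. outer_rate n - (6 * real n - 6)) \<longlonglongrightarrow> 0" by (rule Lim_transform_eventually)
qed (use rates inner_rate_add_outer_rate in auto)

end
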